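(* Let $(X,d_X)$ and $(Y,d_Y)$ be unbounded chain-connected proper metric spaces. For $\omega\in\mathcal{SO}_{\sharp}(Y)$ (resp. $\omega\in\mathcal{SO}_{\sharp}^{\ast}(Y)$) and $\tau\in\mathrm{H}_{\mathcal{C}}(X,Y)$, define $\Phi(\omega,\tau)=\omega\cdot(\tau^{-1})^{\ast}$, that is, $\Phi(\omega,\tau)(f)=\omega\cdot(f\circ\tau^{-1})$ for $f\in\mathcal{SO}(X)$ (resp. $f\in\mathcal{SO}^{\ast}(X)$). Then $\Phi$ induces bijections $$\mathcal{SO}_{\sharp}(Y)\times\mathrm{H}_{\mathcal{C}}(X,Y)\to\mathscr{I}_{\mathcal{SO}}(X,Y)\quad\text{and}\quad \mathcal{SO}_{\sharp}^{\ast}(Y)\times\mathrm{H}_{\mathcal{C}}(X,Y)\to\mathscr{I}_{\mathcal{SO}^{\ast}}(X,Y).$$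
   Context: A metric space is proper if all its closed balls are compact. For $r>0$, $X$ is $r$-chain connected if for any $x,x'\in X$ there are finitely many points $p_0=x,p_1,\dots,p_n=x'$ in $X$ with $d_X(p_{i-1},p_i)\le r$ for $i=1,\dots,n$; $X$ is chain-connected if it is $r$-chain connected for some $r>0$. A continuous $f:X\to\mathbb{R}$ on a proper metric space is slowly oscillating if for every $R>0$ and $\varepsilon>0$ there is a compact $K\subset X$ with $\operatorname{diam} f(B_{d_X}(x,R))<\varepsilon$ for every $x\in X\setminus K$, where $B_{d_X}(x,R)$ is the closed ball. $\mathcal{SO}(X)$ is the vector lattice (pointwise $\wedge=\min$, $\vee=\max$) of all continuous slowly oscillating functions $X\to\mathbb{R}$ and $\mathcal{SO}^{\ast}(X)$ the sublattice of bounded ones. $\mathcal{SO}_{\sharp}(Y)$ is the set of $\omega\in\mathcal{SO}(Y)$ such that $\omega>0$ everywhere and, for every $f\in\mathcal{SO}(Y)$, $\omega\cdot f\in\mathcal{SO}(Y)$ and $(1/\omega)\cdot f\in\mathcal{SO}(Y)$. $\mathcal{SO}_{\sharp}^{\ast}(Y)$ is the set of $\omega\in\mathcal{SO}^{\ast}(Y)$ such that $\omega>0$ everywhere and, for every $f\in\mathcal{SO}^{\ast}(Y)$, $\omega\cdot f\in\mathcal{SO}^{\ast}(Y)$ and $(1/\omega)\cdot f\in\mathcal{SO}^{\ast}(Y)$. A linear lattice isomorphism is a linear bijection preserving $\vee$ and $\wedge$; $\mathscr{I}_{\mathcal{SO}}(X,Y)$ (resp. $\mathscr{I}_{\mathcal{SO}^{\ast}}(X,Y)$)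 is the set of all linear lattice isomorphisms from $\mathcal{SO}(X)$ onto $\mathcal{SO}(Y)$ (resp. from $\mathcal{SO}^{\ast}(X)$ onto $\mathcal{SO}^{\ast}(Y)$). A map $f:X\to Y$ is uniformly expansive if there is a non-decreasing $\sigma:[0,\infty)\to[0,\infty)$ with $d_Y(f(x),f(x'))\le\sigma(d_X(x,x'))$ for all $x,x'\in X$; metrically proper if preimages of bounded sets are bounded; a coarse map if it is both. A homeomorphism $f$ is a coarse homeomorphism if both $f$ and $f^{-1}$ are coarse maps; $\mathrm{H}_{\mathcal{C}}(X,Y)$ is the set of all coarse homeomorphisms from $X$ to $Y$. For a continuous map $h$, $h^{\ast}$ denotes the composition operator $h^{\ast}(f)=f\circ h$. *)

theory Defs
  imports "HOL-Analysis.Analysis"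
begin

text \<open>Metric spaces are types of class \<^class>\<open>metric_space\<close>; the space is the whole type.\<close>

definition proper_metric :: "'a::metric_space itself \<Rightarrow> bool" where
  "proper_metric _ \<longleftrightarrow> (\<forall>(x::'a) r. compact (cball x r))"

definition r_chain_connected :: "real \<Rightarrow> 'a::metric_space itself \<Rightarrow> bool" where
  "r_chain_connected r _ \<longleftrightarrow>
     (\<forall>x x'::'a. \<exists>n. \<exists>p::nat \<Rightarrow> 'a.
        p 0 = x \<and> p n = x' \<and> (\<forall>i\<in>{1..n}. dist (p (i - 1)) (p i) \<le> r))"

definition chain_connected :: "'a::metric_space itself \<Rightarrow> bool" where
  "chain_connected T \<longleftrightarrow> (\<exists>r>0. r_chain_connected r T)"

text \<open>On a proper space, \<^term>\<open>f ` cball x R\<close> is compact for continuous \<^term>\<open>f\<close>, so \<^const>\<open>diameter\<close>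
  (a supremum of reals, junk on unbounded sets) is the true diameter wherever it is used below.\<close>

definition slowly_oscillating :: "('a::metric_space \<Rightarrow> real) \<Rightarrow> bool" where
  "slowly_oscillating f \<longleftrightarrow>
     (\<forall>R>0. \<forall>\<epsilon>>0. \<exists>K. compact K \<and> (\<forall>x. x \<notin> K \<longrightarrow> diameter (f ` cball x R) < \<epsilon>))"

definition SO :: "('a::metric_space \<Rightarrow> real) set" where
  "SO = {f. continuous_on UNIV f \<and> slowly_oscillating f}"

definition SO_bdd :: "('a::metric_space \<Rightarrow> real) set" where
  "SO_bdd = {f \<in> SO. bounded (range f)}"

definition SO_sharp :: "('b::metric_space \<Rightarrow> real) set" where
  "SO_sharp = {\<omega> \<in> SO. (\<forall>y. \<omega> y > 0) \<and>
     (\<forall>f\<in>SO. (\<lambda>y. \<omega> y * f y) \<in> SO \<and> (\<lambda>y. (1 / \<omega> y) * f y) \<in> SO)}"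

definition SO_sharp_bdd :: "('b::metric_space \<Rightarrow> real) set" where
  "SO_sharp_bdd = {\<omega> \<in> SO_bdd. (\<forall>y. \<omega> y > 0) \<and>
     (\<forall>f\<in>SO_bdd. (\<lambda>y. \<omega> y * f y) \<in> SO_bdd \<and> (\<lambda>y. (1 / \<omega> y) * f y) \<in> SO_bdd)}"

text \<open>Operators with domain \<^term>\<open>A\<close> are represented by their extensional representatives
  (value \<^const>\<open>undefined\<close> off \<^term>\<open>A\<close>), so that equality of operators is equality on \<^term>\<open>A\<close>.\<close>

definition linear_lattice_isos ::
  "('a \<Rightarrow> real) set \<Rightarrow> ('b \<Rightarrow> real) set \<Rightarrow> (('a \<Rightarrow> real) \<Rightarrow> ('b \<Rightarrow> real)) set" where
  "linear_lattice_isos A B = {T \<in> extensional A. bij_betw T A B \<and>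
     (\<forall>f\<in>A. \<forall>g\<in>A. T (\<lambda>x. f x + g x) = (\<lambda>y. T f y + T g y)) \<and>
     (\<forall>c. \<forall>f\<in>A. T (\<lambda>x. c * f x) = (\<lambda>y. c * T f y)) \<and>
     (\<forall>f\<in>A. \<forall>g\<in>A. T (\<lambda>x. max (f x) (g x)) = (\<lambda>y. max (T f y) (T g y))) \<and>
     (\<forall>f\<in>A. \<forall>g\<in>A. T (\<lambda>x. min (f x) (g x)) = (\<lambda>y. min (T f y) (T g y)))}"

definition uniformly_expansive :: "('a::metric_space \<Rightarrow> 'b::metric_space) \<Rightarrow> bool" where
  "uniformly_expansive f \<longleftrightarrow>
     (\<exists>\<sigma>::real \<Rightarrow> real. \<sigma> \<in> {0..} \<rightarrow> {0..} \<and> mono_on {0..} \<sigma> \<and>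
        (\<forall>x x'. dist (f x) (f x') \<le> \<sigma> (dist x x')))"

definition metrically_proper :: "('a::metric_space \<Rightarrow> 'b::metric_space) \<Rightarrow> bool" where
  "metrically_proper f \<longleftrightarrow> (\<forall>B. bounded B \<longrightarrow> bounded (f -` B))"

definition coarse_map :: "('a::metric_space \<Rightarrow> 'b::metric_space) \<Rightarrow> bool" where
  "coarse_map f \<longleftrightarrow> uniformly_expansive f \<and> metrically_proper f"

definition coarse_homeomorphisms :: "('a::metric_space \<Rightarrow> 'b::metric_space) set" where
  "coarse_homeomorphisms =
     {\<tau>. homeomorphism UNIV UNIV \<tau> (inv \<tau>) \<and> coarse_map \<tau> \<and> coarse_map (inv \<tau>)}"

definition weighted_comp ::
  "('a \<Rightarrow> real) set \<Rightarrow> ('b \<Rightarrow> real) \<times> ('a \<Rightarrow> 'b) \<Rightarrow> ('a \<Rightarrow> real) \<Rightarrow> ('b \<Rightarrow> real)" where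
  "weighted_comp A = (\<lambda>(\<omega>, \<tau>). \<lambda>f\<in>A. \<lambda>y. \<omega> y * (f \<circ> inv \<tau>) y)"

end

theory Submission
  imports Defs
begin

text \<open>
  Write \<open>A\<close> and \<open>B\<close> for the function lattices on \<open>X\<close> and \<open>Y\<close>. That a weighted composition by a
  multiplier and a coarse homeomorphism is a lattice isomorphism is a direct check, since
  composing with a coarse map preserves slow oscillation. It is determined by its data because
  its value at the constant \<open>1\<close> is the weight, and \<open>A\<close> separates points. The content is that every
  isomorphism \<open>T\<close> has this form.

  \<^emph>\<open>The weight is positive.\<close> Put \<open>\<omega> = T 1\<close>. If \<open>\<omega> y = 0\<close>, the functional \<open>f \<mapsto> T f y\<close> kills the
  constants but not everything. Every nonnegative \<open>f\<close> in \<open>A\<close> is dominated by some \<open>F\<close> in \<open>A\<close> in the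
  sense that \<open>n f \<le> F + C\<^sub>n\<close> for all \<open>n\<close> (\<open>SO_superlinear\<close>: a convex function of \<open>f\<close> of superlinear but
  very slow growth still oscillates slowly). So \<open>n * T f y \<le> T F y\<close> for all \<open>n\<close>, which is absurd if
  \<open>T f = 1\<close>.

  \<^emph>\<open>Points go to points\<close> (\<open>evaluation_point\<close>). Let \<open>h\<close> be \<open>\<omega>\<close> times a tent with its peak at \<open>y\<close>, and
  \<open>u = T\<^sup>-\<^sup>1 h\<close>, so that \<open>u \<le> 1\<close>. A function below \<open>u\<close> with supremum \<open>1\<close> must be sent to a function with value
  \<open>\<omega> y\<close> at \<open>y\<close>, as there is no other place where \<open>h\<close> comes close to \<open>\<omega>\<close>. If \<open>u\<close> came close to \<open>1\<close> arbitrarily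
  far out, a slowly oscillating \<open>f\<close> taking both values \<open>0\<close> and \<open>1\<close> along such points would give two
  functions, \<open>min f u\<close> and \<open>min (1 - f) u\<close>, with that property, and the values of \<open>T f\<close> and \<open>T (1 - f)\<close>
  at \<open>y\<close> would add up to at least \<open>2 \<omega> y\<close> instead of \<open>\<omega> y\<close>. So \<open>u\<close> attains \<open>1\<close> at some \<open>x\<close>, and then
  \<open>T f y = \<omega> y * f x\<close> for all \<open>f\<close>. Doing the same for \<open>T\<^sup>-\<^sup>1\<close> yields mutually inverse continuous maps
  between \<open>X\<close> and \<open>Y\<close>.

  \<^emph>\<open>The weight is bounded above and away from zero\<close> (\<open>weight_bounded_above\<close>). The product of \<open>\<omega>\<close> with any
  continuous function vanishing at infinity oscillates slowly. If \<open>\<omega>\<close> were unbounded, such a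
  function could be chosen to have \<open>\<omega> g \<ge> 1\<close> at points where \<open>\<omega>\<close> is large and \<open>g = 0\<close> at a bounded
  distance from them; chain connectedness supplies these second points. The bound below is
  the bound above for \<open>T\<^sup>-\<^sup>1\<close>.

  \<^emph>\<open>The homeomorphism is coarse\<close> (\<open>uniformly_expansive_if_pullback_SO\<close>). The composition of a bounded
  slowly oscillating \<open>f\<close> with the point map from \<open>Y\<close> to \<open>X\<close> is \<open>T f\<close> divided by \<open>\<omega>\<close>, hence oscillates slowly. If the
  point map moved pairs of uniformly close points arbitrarily far apart, these pairs would be separated by a
  slowly oscillating function whose pullback does not oscillate slowly.

  Both uses of separating functions rest on \<open>divergent_pairs_separation\<close>. The arguments are carried
  out once, for an abstract lattice between \<^const>\<open>SO_bdd\<close> and \<^const>\<open>SO\<close>.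
\<close>

section \<open>Slow oscillation on proper spaces\<close>

lemma bounded_imp_in_compact:
  assumes "proper_metric TYPE('a::metric_space)" and "bounded (S :: 'a set)"
  shows "\<exists>K. compact K \<and> S \<subseteq> K"
  using assms unfolding proper_metric_def bounded_subset_cball by blast

lemma bounded_neighbourhood:
  fixes S :: "'a::metric_space set"
  assumes "bounded S"
  shows "bounded {x. \<exists>x'\<in>S. dist x x' \<le> R}"
proof -
  obtain b r where br: "\<And>x. x \<in> S \<Longrightarrow> dist b x \<le> r"
    using assms unfolding bounded_def by blast
  have "dist b x \<le> r + R" if "x' \<in> S" "dist x x' \<le> R" for x x'
    using br[OF that(1)] that(2) dist_triangle2[of b x x'] by linarith
  then show ?thesis unfolding bounded_def by blast
qed

text \<open>Membership in \<^const>\<open>SO\<close> in terms of pairs of points and bounded exceptional sets. On a proper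
  space bounded sets have compact closure, so they serve as well as compact ones and are easier to
  handle.\<close>

lemma SO_iff:
  fixes f :: "'a::metric_space \<Rightarrow> real"
  assumes "proper_metric TYPE('a)"
  shows "f \<in> SO \<longleftrightarrow> continuous_on UNIV f \<and>
    (\<forall>R. \<forall>\<epsilon>>0. \<exists>K. bounded K \<and> (\<forall>x x'. x \<notin> K \<longrightarrow> dist x x' \<le> R \<longrightarrow> \<bar>f x - f x'\<bar> \<le> \<epsilon>))"
    (is "_ \<longleftrightarrow> _ \<and> ?osc")
proof (intro iffI conjI allI impI)
  assume "f \<in> SO"
  then show cont: "continuous_on UNIV f" by (simp add: SO_def)
  fix R \<epsilon> :: real assume "\<epsilon> > 0"
  with \<open>f \<in> SO\<close> obtain K where K: "compact K"
    "\<And>x. x \<notin> K \<Longrightarrow> diameter (f ` cball x (max R 1)) < \<epsilon>"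
  proof -
    have "max R 1 > 0" by simp
    with \<open>f \<in> SO\<close> \<open>\<epsilon> > 0\<close> show thesis
      using that unfolding SO_def slowly_oscillating_def by blast
  qed
  have "\<bar>f x - f x'\<bar> \<le> \<epsilon>" if "x \<notin> K" "dist x x' \<le> R" for x x'
  proof -
    have "compact (f ` cball x (max R 1))"
      using assms cont unfolding proper_metric_def
      by (meson compact_continuous_image continuous_on_subset subset_UNIV)
    then have "dist (f x) (f x') \<le> diameter (f ` cball x (max R 1))"
      using that(2) by (intro diameter_bounded_bound compact_imp_bounded) auto
    with K(2)[OF that(1)] show ?thesis by (simp add: dist_real_def)
  qed
  with compact_imp_bounded[OF K(1)]
  show "\<exists>K. bounded K \<and> (\<forall>x x'. x \<notin> K \<longrightarrow> dist x x' \<le> R \<longrightarrow> \<bar>f x - f x'\<bar> \<le> \<epsilon>)" by blast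
next
  assume *: "continuous_on UNIV f \<and> ?osc"
  have "\<exists>K. compact K \<and> (\<forall>x. x \<notin> K \<longrightarrow> diameter (f ` cball x R) < \<epsilon>)"
    if "R > 0" "\<epsilon> > 0" for R \<epsilon>
  proof -
    have "\<epsilon> / 3 > 0" using \<open>\<epsilon> > 0\<close> by simp
    with * obtain K0 where K0: "bounded K0"
      "\<And>x x'. x \<notin> K0 \<Longrightarrow> dist x x' \<le> R \<Longrightarrow> \<bar>f x - f x'\<bar> \<le> \<epsilon> / 3"
      by blast
    obtain K where K: "compact K" "K0 \<subseteq> K" using bounded_imp_in_compact[OF assms K0(1)] by blast
    have "diameter (f ` cball x R) < \<epsilon>" if "x \<notin> K" for x
    proof -
      have "x \<notin> K0" using \<open>x \<notin> K\<close> K(2) by blast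
      then have "\<bar>f x - f a\<bar> \<le> \<epsilon> / 3" if "a \<in> cball x R" for a
        using K0(2) that by simp
      then have "norm (f a - f b) \<le> 2 * (\<epsilon> / 3)" if "a \<in> cball x R" "b \<in> cball x R" for a b
        using that by (smt (verit) real_norm_def)
      then have "diameter (f ` cball x R) \<le> 2 * (\<epsilon> / 3)"
        using \<open>\<epsilon> > 0\<close> by (intro diameter_le) auto
      with \<open>\<epsilon> > 0\<close> show ?thesis by linarith
    qed
    with K(1) show ?thesis by blast
  qed
  with * show "f \<in> SO" by (simp add: SO_def slowly_oscillating_def)
qed

lemma SO_continuous: "f \<in> SO \<Longrightarrow> continuous_on UNIV f"
  by (simp add: SO_def)

lemma SO_oscillation:
  assumes "proper_metric TYPE('a::metric_space)" "(f :: 'a \<Rightarrow> real) \<in> SO" "\<epsilon> > 0"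
  obtains K where "bounded K" "\<And>x x'. x \<notin> K \<Longrightarrow> dist x x' \<le> R \<Longrightarrow> \<bar>f x - f x'\<bar> \<le> \<epsilon>"
  using assms(2,3) unfolding SO_iff[OF assms(1)] by blast

text \<open>The source of all closure properties: pointwise, the oscillation of \<open>h\<close> is controlled by
  those of \<open>f\<close> and \<open>g\<close>.\<close>

lemma SO_combine:
  fixes f g h :: "'a::metric_space \<Rightarrow> real"
  assumes proper: "proper_metric TYPE('a)"
    and f: "f \<in> SO" and g: "g \<in> SO" and "continuous_on UNIV h"
    and lip: "\<And>x x'. \<bar>h x - h x'\<bar> \<le> L * (\<bar>f x - f x'\<bar> + \<bar>g x - g x'\<bar>)"
  shows "h \<in> SO"
  unfolding SO_iff[OF proper]
proof (intro conjI allI impI)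
  fix R \<epsilon> :: real assume "\<epsilon> > 0"
  define \<delta> where "\<delta> = \<epsilon> / (2 * (\<bar>L\<bar> + 1))"
  have "\<delta> > 0" using \<open>\<epsilon> > 0\<close> by (simp add: \<delta>_def)
  obtain K where K: "bounded K" "\<And>x x'. x \<notin> K \<Longrightarrow> dist x x' \<le> R \<Longrightarrow> \<bar>f x - f x'\<bar> \<le> \<delta>"
    using SO_oscillation[OF proper f \<open>\<delta> > 0\<close>] by blast
  obtain K' where K': "bounded K'" "\<And>x x'. x \<notin> K' \<Longrightarrow> dist x x' \<le> R \<Longrightarrow> \<bar>g x - g x'\<bar> \<le> \<delta>"
    using SO_oscillation[OF proper g \<open>\<delta> > 0\<close>] by blast
  have "\<bar>h x - h x'\<bar> \<le> \<epsilon>" if "x \<notin> K \<union> K'" "dist x x' \<le> R" for x x'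
  proof -
    let ?s = "\<bar>f x - f x'\<bar> + \<bar>g x - g x'\<bar>"
    have "\<bar>h x - h x'\<bar> \<le> L * ?s" by (rule lip)
    also have "\<dots> \<le> (\<bar>L\<bar> + 1) * ?s" by (intro mult_right_mono) auto
    also have "\<dots> \<le> (\<bar>L\<bar> + 1) * (2 * \<delta>)"
      using K(2)[of x x'] K'(2)[of x x'] that by (intro mult_left_mono) auto
    also have "\<dots> = \<epsilon>" by (simp add: \<delta>_def field_simps)
    finally show ?thesis .
  qed
  moreover have "bounded (K \<union> K')" using K(1) K'(1) by simp
  ultimately show "\<exists>K. bounded K \<and> (\<forall>x x'. x \<notin> K \<longrightarrow> dist x x' \<le> R \<longrightarrow> \<bar>h x - h x'\<bar> \<le> \<epsilon>)"
    by blast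
qed fact

lemma bounded_range_real_iff:
  fixes f :: "'a \<Rightarrow> real"
  shows "bounded (range f) \<longleftrightarrow> (\<exists>M. \<forall>x. \<bar>f x\<bar> \<le> M)"
  by (auto simp: bounded_iff)

lemma vanishing_at_infinity_SO_bdd:
  fixes g :: "'a::metric_space \<Rightarrow> real"
  assumes proper: "proper_metric TYPE('a)" and cont: "continuous_on UNIV g"
    and vanish: "\<And>\<epsilon>. \<epsilon> > 0 \<Longrightarrow> bounded {x. \<bar>g x\<bar> \<ge> \<epsilon>}"
  shows "g \<in> SO_bdd"
proof -
  have "g \<in> SO" unfolding SO_iff[OF proper]
  proof (intro conjI allI impI)
    fix R \<epsilon> :: real assume "\<epsilon> > 0"
    define S where "S = {x. \<bar>g x\<bar> \<ge> \<epsilon> / 2}"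
    have S: "bounded S" using vanish[of "\<epsilon> / 2"] \<open>\<epsilon> > 0\<close> by (simp add: S_def)
    \<comment> \<open>Outside the \<open>R\<close>-neighbourhood of \<open>S\<close>, both points have small values.\<close>
    have "\<bar>g x - g x'\<bar> \<le> \<epsilon>"
      if "x \<notin> S \<union> {x. \<exists>x'\<in>S. dist x x' \<le> R}" "dist x x' \<le> R" for x x'
    proof -
      have "x \<notin> S" "x' \<notin> S" using that by auto
      then show ?thesis by (auto simp: S_def)
    qed
    moreover have "bounded (S \<union> {x. \<exists>x'\<in>S. dist x x' \<le> R})"
      using S bounded_neighbourhood[OF S, of R] by simp
    ultimately show "\<exists>K. bounded K \<and> (\<forall>x x'. x \<notin> K \<longrightarrow> dist x x' \<le> R \<longrightarrow> \<bar>g x - g x'\<bar> \<le> \<epsilon>)"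
      by blast
  qed fact
  moreover have "bounded (range g)"
  proof -
    obtain K where K: "compact K" "{x. \<bar>g x\<bar> \<ge> 1} \<subseteq> K"
      using bounded_imp_in_compact[OF proper vanish[of 1]] by auto
    have "bounded (g ` K)"
      using K(1) cont by (meson compact_continuous_image compact_imp_bounded continuous_on_subset subset_UNIV)
    then obtain M where M: "\<And>x. x \<in> K \<Longrightarrow> \<bar>g x\<bar> \<le> M" by (auto simp: bounded_iff)
    have "\<bar>g x\<bar> \<le> max M 1" for x
      using M[of x] K(2) by (cases "\<bar>g x\<bar> \<ge> 1") auto
    then show ?thesis unfolding bounded_range_real_iff by blast
  qed
  ultimately show ?thesis by (simp add: SO_bdd_def)
qed

definition tent :: "'a::metric_space \<Rightarrow> 'a \<Rightarrow> real" where
  "tent p x = max 0 (1 - dist p x)"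

lemma tent_SO_bdd:
  assumes "proper_metric TYPE('a::metric_space)" "continuous_on UNIV (e :: 'a \<Rightarrow> real)"
  shows "(\<lambda>x. e x * tent p x) \<in> SO_bdd"
proof (rule vanishing_at_infinity_SO_bdd[OF assms(1)])
  show "continuous_on UNIV (\<lambda>x. e x * tent p x)"
    unfolding tent_def by (intro continuous_intros assms)
  fix \<epsilon> :: real assume "\<epsilon> > 0"
  then have "{x. \<epsilon> \<le> \<bar>e x * tent p x\<bar>} \<subseteq> cball p 1"
    by (auto simp: tent_def max_def split: if_splits)
  then show "bounded {x. \<epsilon> \<le> \<bar>e x * tent p x\<bar>}" by (meson bounded_cball bounded_subset)
qed

section \<open>Functions separating sparse sequences\<close>

text \<open>Points are picked one after the other, each beyond all earlier ones by a margin that grows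
  with \<open>n\<close>. The sizes \<open>lo\<close> and \<open>hi\<close> differ because the objects picked are pairs of points (with a nearest
  and a farthest member) or points together with a neighbourhood.\<close>

lemma sparse_sequence:
  fixes lo hi :: "'c \<Rightarrow> real"
  assumes "\<And>n M. \<exists>z. P n z \<and> M \<le> lo z"
  shows "\<exists>z. \<forall>n. P n (z n) \<and> (\<forall>m<n. hi (z m) + real n + 1 \<le> lo (z n))"
proof (rule dependent_wellorder_choice)
  fix n :: nat and z :: "nat \<Rightarrow> 'c"
  obtain w where "P n w" "Max (insert 0 ((\<lambda>m. hi (z m)) ` {..<n})) + real n + 1 \<le> lo w"
    using assms by blast
  moreover have "hi (z m) \<le> Max (insert 0 ((\<lambda>m. hi (z m)) ` {..<n}))" if "m < n" for m
    using that by (intro Max_ge) auto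
  ultimately show "\<exists>w. P n w \<and> (\<forall>m<n. hi (z m) + real n + 1 \<le> lo w)"
    by (smt (verit))
qed auto

text \<open>The Urysohn function of two sets that diverge from each other. With \<open>D = infdist x A +
  infdist x B\<close>, moving the point by \<open>R\<close> changes the quotient by at most \<open>R / D\<close>, and \<open>D\<close> tends to
  infinity.\<close>

lemma infdist_quotient_SO_bdd:
  fixes A B :: "'a::metric_space set"
  assumes proper: "proper_metric TYPE('a)"
    and pos: "\<And>x. infdist x A + infdist x B > 0"
    and div: "\<And>R. bounded {x. infdist x A + infdist x B \<le> R}"
  shows "(\<lambda>x. infdist x A / (infdist x A + infdist x B)) \<in> SO_bdd" (is "?f \<in> _")
proof -
  let ?D = "\<lambda>x. infdist x A + infdist x B"
  have osc: "\<bar>?f x - ?f x'\<bar> \<le> dist x x' / ?D x" for x x'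
  proof -
    let ?a = "infdist x A" and ?b = "infdist x B" and ?a' = "infdist x' A" and ?b' = "infdist x' B"
    have D: "?D x > 0" "?D x' > 0" by (rule pos)+
    have "?f x - ?f x' = (?a * ?b' - ?a' * ?b) / (?D x * ?D x')"
      using D by (simp add: field_simps)
    also have "?a * ?b' - ?a' * ?b = (?a - ?a') * ?b' + ?a' * (?b' - ?b)"
      by (simp add: algebra_simps)
    finally have "\<bar>?f x - ?f x'\<bar> = \<bar>(?a - ?a') * ?b' + ?a' * (?b' - ?b)\<bar> / (?D x * ?D x')"
      using D by simp
    also have "\<dots> \<le> (dist x x' * ?b' + ?a' * dist x x') / (?D x * ?D x')"
    proof (intro divide_right_mono)
      have "\<bar>(?a - ?a') * ?b'\<bar> \<le> dist x x' * ?b'" "\<bar>?a' * (?b' - ?b)\<bar> \<le> ?a' * dist x x'"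
        using infdist_triangle_abs[of x A x'] infdist_triangle_abs[of x' B x]
        by (auto simp: abs_mult infdist_nonneg dist_commute intro!: mult_right_mono mult_left_mono)
      then show "\<bar>(?a - ?a') * ?b' + ?a' * (?b' - ?b)\<bar> \<le> dist x x' * ?b' + ?a' * dist x x'"
        by linarith
    qed (use D in auto)
    also have "dist x x' * ?b' + ?a' * dist x x' = dist x x' * ?D x'" by (simp add: algebra_simps)
    also have "dist x x' * ?D x' / (?D x * ?D x') = dist x x' / ?D x" using D by simp
    finally show ?thesis .
  qed
  have "?f \<in> SO" unfolding SO_iff[OF proper]
  proof (intro conjI allI impI)
    show "continuous_on UNIV ?f" using pos by (intro continuous_intros) (metis less_irrefl)
    fix R \<epsilon> :: real assume "\<epsilon> > 0"
    have "\<bar>?f x - ?f x'\<bar> \<le> \<epsilon>" if "x \<notin> {x. ?D x \<le> R / \<epsilon>}" "dist x x' \<le> R" for x x'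
    proof -
      have "dist x x' / ?D x \<le> R / ?D x" using that(2) pos[of x] by (simp add: divide_right_mono)
      also have "\<dots> \<le> \<epsilon>" using that(1) \<open>\<epsilon> > 0\<close> pos[of x] by (simp add: field_simps)
      finally show ?thesis using osc[of x x'] by linarith
    qed
    with div show "\<exists>K. bounded K \<and> (\<forall>x x'. x \<notin> K \<longrightarrow> dist x x' \<le> R \<longrightarrow> \<bar>?f x - ?f x'\<bar> \<le> \<epsilon>)"
      by blast
  qed
  moreover have "\<bar>?f x\<bar> \<le> 1" for x
    using pos[of x] infdist_nonneg[of x A] infdist_nonneg[of x B] by simp
  ultimately show ?thesis unfolding SO_bdd_def bounded_range_real_iff by blast
qed

lemma infdist_le_obtains:
  assumes "A \<noteq> {}" "infdist x A \<le> r" "r < s"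
  obtains a where "a \<in> A" "dist x a < s"
proof -
  have "bdd_below (dist x ` A)" by (rule bdd_belowI2[of _ 0]) simp
  moreover have "(INF a\<in>A. dist x a) < s" using assms by (simp add: infdist_notempty)
  ultimately show thesis using that assms(1) by (auto simp: cINF_less_iff)
qed

text \<open>A point close to some \<open>a k\<close> and to some \<open>b l\<close> forces \<open>k\<close> and \<open>l\<close> to be small, so the ranges of
  the two sequences diverge from each other.\<close>

lemma sequence_separation:
  fixes a b :: "nat \<Rightarrow> 'a::metric_space"
  assumes proper: "proper_metric TYPE('a)"
    and far: "\<And>k l. max (real k) (real l) + 1 \<le> dist (a k) (b l)"
  shows "\<exists>f\<in>SO_bdd. \<forall>n. f (a n) = 0 \<and> f (b n) = 1"
proof -
  let ?A = "range a" and ?B = "range b"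
  let ?f = "\<lambda>x. infdist x ?A / (infdist x ?A + infdist x ?B)"
  have near: "\<exists>k l. dist x (a k) < s \<and> dist x (b l) < s \<and> real k \<le> 2 * s \<and> 1 \<le> 2 * s"
    if "infdist x ?A + infdist x ?B \<le> r" "r < s" for x r s
  proof -
    have A: "infdist x ?A \<le> r" and B: "infdist x ?B \<le> r"
      using that(1) infdist_nonneg[of x ?A] infdist_nonneg[of x ?B] by linarith+
    obtain k where k: "dist x (a k) < s"
      by (rule infdist_le_obtains[OF _ A \<open>r < s\<close>]) auto
    obtain l where l: "dist x (b l) < s"
      by (rule infdist_le_obtains[OF _ B \<open>r < s\<close>]) auto
    have "max (real k) (real l) + 1 \<le> 2 * s"
      using far[of k l] dist_triangle3[of "a k" "b l" x] k l by linarith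
    with k l show ?thesis by (intro exI[of _ k] exI[of _ l]) linarith
  qed
  have pos: "infdist x ?A + infdist x ?B > 0" for x
    using near[of x 0 "1/4"] by fastforce
  have "bounded {x. infdist x ?A + infdist x ?B \<le> R}" for R
  proof (rule bounded_subset)
    define N where "N = nat \<lceil>2 * (R + 1)\<rceil>"
    show "bounded (\<Union>k\<in>{..N}. cball (a k) (R + 1))" by auto
    show "{x. infdist x ?A + infdist x ?B \<le> R} \<subseteq> (\<Union>k\<in>{..N}. cball (a k) (R + 1))"
    proof
      fix x assume "x \<in> {x. infdist x ?A + infdist x ?B \<le> R}"
      then obtain k where "dist x (a k) < R + 1" "real k \<le> 2 * (R + 1)"
        using near[of x R "R + 1"] by auto
      moreover from this(2) have "k \<le> N" unfolding N_def by linarith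
      ultimately show "x \<in> (\<Union>k\<in>{..N}. cball (a k) (R + 1))"
        by (auto simp: dist_commute intro!: bexI[of _ k])
    qed
  qed
  then have "?f \<in> SO_bdd" by (intro infdist_quotient_SO_bdd proper pos)
  moreover have "?f (a n) = 0" for n by simp
  moreover have "?f (b n) = 1" for n using pos[of "b n"] by simp
  ultimately show ?thesis by (intro bexI[of _ ?f]) blast
qed

text \<open>Thinning out the pairs makes every first member far from every second member, also across
  different pairs. What is needed later about the surviving pairs, such as how far out they come
  from, is put into \<open>P n\<close>.\<close>

lemma divergent_pairs_separation:
  fixes P :: "nat \<Rightarrow> 'a::metric_space \<Rightarrow> 'a \<Rightarrow> bool"
  assumes proper: "proper_metric TYPE('a)"
    and far: "\<And>n M. \<exists>a b. P n a b \<and> M \<le> dist p a \<and> M \<le> dist p b \<and> M \<le> dist a b"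
  obtains f where "f \<in> SO_bdd" "\<And>n. \<exists>a b. P n a b \<and> f a = 0 \<and> f b = 1"
proof -
  let ?lo = "\<lambda>z. min (dist p (fst z)) (dist p (snd z))"
  let ?hi = "\<lambda>z. max (dist p (fst z)) (dist p (snd z))"
  have "\<exists>z. (P n (fst z) (snd z) \<and> real n + 1 \<le> dist (fst z) (snd z)) \<and> M \<le> ?lo z" for n M
    using far[of n "max M (real n + 1)"] by force
  from sparse_sequence[where lo = ?lo and hi = ?hi and
      P = "\<lambda>n z. P n (fst z) (snd z) \<and> real n + 1 \<le> dist (fst z) (snd z)", OF this]
  obtain z where z: "\<And>n. P n (fst (z n)) (snd (z n))"
    "\<And>n. real n + 1 \<le> dist (fst (z n)) (snd (z n))"
    "\<And>m n. m < n \<Longrightarrow> ?hi (z m) + real n + 1 \<le> ?lo (z n)" by metis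
  have "max (real k) (real l) + 1 \<le> dist (fst (z k)) (snd (z l))" for k l
  proof (cases k l rule: linorder_cases)
    case less
    then show ?thesis using z(3)[OF less] dist_triangle[of p "snd (z l)" "fst (z k)"] by linarith
  next
    case equal
    then show ?thesis using z(2)[of k] by simp
  next
    case greater
    then show ?thesis
      using z(3)[OF greater] dist_triangle2[of p "fst (z k)" "snd (z l)"] by linarith
  qed
  from sequence_separation[OF proper, of "\<lambda>n. fst (z n)" "\<lambda>n. snd (z n)", OF this]
  show thesis using that z(1) by meson
qed

section \<open>Lattices of slowly oscillating functions\<close>

text \<open>\<open>F\<close> is the supremum of the functions \<open>n f - C n\<close>, where \<open>C n\<close> is a sum of thresholds \<open>t k\<close>. Slope \<open>n\<close> is
  used only where \<open>f\<close> reaches \<open>t (n - 1)\<close>. As \<open>f\<close> is bounded on bounded sets, a large value of \<open>f\<close> means a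
  point far out, so \<open>t (n - 1)\<close> can be chosen such that \<open>f\<close> varies there by no more than \<open>1 / n\<^sup>2\<close> on balls
  of radius \<open>n\<close>. The slope \<open>n\<close> then does no harm.\<close>

lemma SO_superlinear:
  fixes f :: "'a::metric_space \<Rightarrow> real"
  assumes proper: "proper_metric TYPE('a)" and f: "f \<in> SO" and nonneg: "\<And>x. 0 \<le> f x"
  shows "\<exists>F\<in>SO. \<forall>n. \<exists>C. \<forall>x. real n * f x \<le> F x + C"
proof -
  have "\<exists>t. 2 * real m + 1 \<le> t \<and>
      (\<forall>x x'. t \<le> f x \<longrightarrow> dist x x' \<le> real (Suc m) \<longrightarrow> \<bar>f x - f x'\<bar> \<le> 1 / (real (Suc m))\<^sup>2)" for m
  proof -
    have "1 / (real (Suc m))\<^sup>2 > 0" by simp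
    from SO_oscillation[OF proper f this] obtain K where K: "bounded K"
      "\<And>x x'. x \<notin> K \<Longrightarrow> dist x x' \<le> real (Suc m) \<Longrightarrow> \<bar>f x - f x'\<bar> \<le> 1 / (real (Suc m))\<^sup>2" by blast
    obtain K' where K': "compact K'" "K \<subseteq> K'" using bounded_imp_in_compact[OF proper K(1)] by blast
    have "bounded (f ` K')"
      using K'(1) SO_continuous[OF f]
      by (meson compact_continuous_image compact_imp_bounded continuous_on_subset subset_UNIV)
    then obtain M where M: "\<And>x. x \<in> K' \<Longrightarrow> \<bar>f x\<bar> \<le> M" by (auto simp: bounded_iff)
    have "x \<notin> K" if "max (M + 1) (2 * real m + 1) \<le> f x" for x
      using M[of x] K'(2) that by fastforce
    with K(2) show ?thesis
      by (intro exI[of _ "max (M + 1) (2 * real m + 1)"]) auto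
  qed
  then obtain t where t_ge: "\<And>m. 2 * real m + 1 \<le> t m"
    and t_osc: "\<And>m x x'. t m \<le> f x \<Longrightarrow> dist x x' \<le> real (Suc m) \<Longrightarrow> \<bar>f x - f x'\<bar> \<le> 1 / (real (Suc m))\<^sup>2"
    by metis
  define C where "C n = (\<Sum>k<n. t k)" for n
  \<comment> \<open>The thresholds grow at least like the odd numbers, so the supremum is attained.\<close>
  have C_ge: "(real n)\<^sup>2 \<le> C n" for n
  proof (induction n)
    case (Suc n)
    have "(real (Suc n))\<^sup>2 = (real n)\<^sup>2 + (2 * real n + 1)"
      by (simp add: power2_eq_square algebra_simps)
    with Suc t_ge[of n] show ?case by (simp add: C_def)
  qed (simp add: C_def)
  have "\<exists>n. \<forall>m. real m * f x - C m \<le> real n * f x - C n" for x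
  proof -
    let ?v = "\<lambda>m. real m * f x - C m"
    define L where "L = nat \<lceil>f x\<rceil>"
    have "Max (?v ` {..L}) \<in> ?v ` {..L}" by (intro Max_in) auto
    then obtain n where n: "?v n = Max (?v ` {..L})" unfolding image_iff by metis
    have best: "?v m \<le> ?v n" if "m \<le> L" for m
      unfolding n using that by (intro Max_ge imageI) auto
    have "?v m \<le> ?v n" for m
    proof (cases "m \<le> L")
      case False
      then have "f x \<le> real m" unfolding L_def by linarith
      then have "?v m \<le> real m * real m - C m" by (simp add: mult_left_mono)
      also have "\<dots> \<le> 0" using C_ge[of m] by (simp add: power2_eq_square)
      also have "0 = ?v 0" by (simp add: C_def)
      also have "\<dots> \<le> ?v n" by (rule best) simp
      finally show ?thesis .
    qed (rule best)
    then show ?thesis by blast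
  qed
  then have "\<exists>N. \<forall>x m. real m * f x - C m \<le> real (N x) * f x - C (N x)" by (rule choice[OF allI])
  then obtain N where N: "\<And>x m. real m * f x - C m \<le> real (N x) * f x - C (N x)" by blast
  have N_threshold: "t m \<le> f x" if "N x = Suc m" for x m
    using N[of m x] that by (simp add: C_def algebra_simps)
  have N_le: "real (N x) \<le> f x" for x
  proof (cases "N x")
    case (Suc m)
    then show ?thesis using N_threshold[OF Suc] t_ge[of m] by simp
  qed (simp add: nonneg)
  define F where "F x = real (N x) * f x - C (N x)" for x
  \<comment> \<open>Compare both values with the affine minorant that is optimal at \<open>x\<close>.\<close>
  have F_diff: "F x - F x' \<le> real (N x) * \<bar>f x - f x'\<bar>" for x x'
  proof -
    have "F x - F x' \<le> real (N x) * (f x - f x')"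
      using N[of "N x" x'] by (simp add: F_def algebra_simps)
    also have "\<dots> \<le> real (N x) * \<bar>f x - f x'\<bar>" by (intro mult_left_mono) auto
    finally show ?thesis .
  qed
  have F_abs: "\<bar>F x - F x'\<bar> \<le> (f x + f x') * \<bar>f x - f x'\<bar>" for x x'
  proof -
    have "real (N z) * \<bar>f x - f x'\<bar> \<le> (f x + f x') * \<bar>f x - f x'\<bar>" if "z \<in> {x, x'}" for z
      using N_le[of z] nonneg[of x] nonneg[of x'] that by (intro mult_right_mono) auto
    from this[of x] this[of x'] show ?thesis
      using F_diff[of x x'] F_diff[of x' x] by (simp add: abs_le_iff abs_minus_commute)
  qed
  have "F \<in> SO" unfolding SO_iff[OF proper]
  proof (intro conjI allI impI)
    show "continuous_on UNIV F"
    proof (intro continuous_at_imp_continuous_on ballI)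
      fix x
      have "(f \<longlongrightarrow> f x) (at x)"
        using SO_continuous[OF f] by (simp add: continuous_on_eq_continuous_at isCont_def)
      then have "((\<lambda>x'. (f x + f x') * \<bar>f x - f x'\<bar>) \<longlongrightarrow> (f x + f x) * \<bar>f x - f x\<bar>) (at x)"
        by (intro tendsto_intros)
      then have "((\<lambda>x'. (f x + f x') * \<bar>f x - f x'\<bar>) \<longlongrightarrow> 0) (at x)" by simp
      then have "((\<lambda>x'. F x' - F x) \<longlongrightarrow> 0) (at x)"
        by (rule Lim_null_comparison[rotated]) (use F_abs[of x] in \<open>simp add: abs_minus_commute\<close>)
      then show "isCont F x" by (simp add: isCont_def LIM_zero_cancel)
    qed
    fix R \<epsilon> :: real assume "\<epsilon> > 0"
    define k where "k = Suc (nat \<lceil>max R (1 / \<epsilon>)\<rceil>)"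
    have k: "R \<le> real k" "1 / \<epsilon> \<le> real k" "0 < real k" unfolding k_def by linarith+
    have "\<epsilon> / real k > 0" using \<open>\<epsilon> > 0\<close> k(3) by simp
    from SO_oscillation[OF proper f this] obtain K where K: "bounded K"
      "\<And>x x'. x \<notin> K \<Longrightarrow> dist x x' \<le> R \<Longrightarrow> \<bar>f x - f x'\<bar> \<le> \<epsilon> / real k" by blast
    have step: "real (N z) * \<bar>f z - f z'\<bar> \<le> \<epsilon>"
      if "\<bar>f z - f z'\<bar> \<le> \<epsilon> / real k" "dist z z' \<le> R" for z z'
    proof (cases "N z \<le> k")
      case True
      then have "real (N z) * \<bar>f z - f z'\<bar> \<le> real k * (\<epsilon> / real k)"
        using that(1) by (intro mult_mono) auto
      with k(3) show ?thesis by simp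
    next
      case False
      then obtain m where m: "N z = Suc m" "k \<le> m" by (cases "N z") auto
      have "real (N z) * \<bar>f z - f z'\<bar> \<le> real (Suc m) * (1 / (real (Suc m))\<^sup>2)"
        unfolding m(1) using m that(2) k(1)
        by (intro mult_left_mono t_osc N_threshold) auto
      also have "\<dots> = 1 / real (Suc m)" by (simp add: power2_eq_square)
      also have "\<dots> \<le> 1 / real k" using m(2) k(3) by (intro divide_left_mono) auto
      also have "\<dots> \<le> \<epsilon>" using k(2,3) \<open>\<epsilon> > 0\<close> by (simp add: field_simps)
      finally show ?thesis .
    qed
    have "\<bar>F x - F x'\<bar> \<le> \<epsilon>" if "x \<notin> K" "dist x x' \<le> R" for x x'
      using step[of x x'] step[of x' x] K(2)[OF that] that(2) F_diff[of x x'] F_diff[of x' x]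
      by (simp add: abs_minus_commute dist_commute)
    with K(1) show "\<exists>K. bounded K \<and> (\<forall>x x'. x \<notin> K \<longrightarrow> dist x x' \<le> R \<longrightarrow> \<bar>F x - F x'\<bar> \<le> \<epsilon>)"
      by blast
  qed
  moreover have "real n * f x \<le> F x + C n" for n x
    using N[of n x] by (simp add: F_def)
  ultimately show ?thesis by blast
qed

text \<open>The common features of \<^const>\<open>SO\<close> and \<^const>\<open>SO_bdd\<close> from which the representation theorem follows.
  The last one excludes nonzero lattice homomorphisms to the reals that kill the constants.\<close>

locale slow_lattice =
  fixes A :: "('a::metric_space \<Rightarrow> real) set"
  assumes proper: "proper_metric TYPE('a)"
    and SO_bdd_subset: "SO_bdd \<subseteq> A"
    and subset_SO: "A \<subseteq> SO"
    and add_closed: "f \<in> A \<Longrightarrow> g \<in> A \<Longrightarrow> (\<lambda>x. f x + g x) \<in> A"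
    and scale_closed: "f \<in> A \<Longrightarrow> (\<lambda>x. c * f x) \<in> A"
    and max_closed: "f \<in> A \<Longrightarrow> g \<in> A \<Longrightarrow> (\<lambda>x. max (f x) (g x)) \<in> A"
    and min_closed: "f \<in> A \<Longrightarrow> g \<in> A \<Longrightarrow> (\<lambda>x. min (f x) (g x)) \<in> A"
    and superlinear_minorant:
      "f \<in> A \<Longrightarrow> (\<And>x. 0 \<le> f x) \<Longrightarrow> \<exists>F\<in>A. \<forall>n. \<exists>C. \<forall>x. real n * f x \<le> F x + C"
begin

lemma diff_closed: "f \<in> A \<Longrightarrow> g \<in> A \<Longrightarrow> (\<lambda>x. f x - g x) \<in> A"
  using add_closed[of f "\<lambda>x. -1 * g x"] scale_closed[of g "-1"] by simp

lemma SO_bdd_mem: "f \<in> SO_bdd \<Longrightarrow> f \<in> A"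
  using SO_bdd_subset by blast

lemma const_mem: "(\<lambda>_. c) \<in> A"
proof (rule SO_bdd_mem)
  have "(\<lambda>_::'a. c) \<in> SO" using bounded_empty by (auto simp: SO_iff[OF proper])
  moreover have "bounded (range (\<lambda>_::'a. c))" by simp
  ultimately show "(\<lambda>_::'a. c) \<in> SO_bdd" by (simp add: SO_bdd_def)
qed

lemma continuous: "f \<in> A \<Longrightarrow> continuous_on UNIV f"
  using subset_SO SO_continuous by blast

lemma tent_mem: "continuous_on UNIV e \<Longrightarrow> (\<lambda>x. e x * tent p x) \<in> A"
  by (intro SO_bdd_mem tent_SO_bdd proper)

lemma separates_points:
  assumes "\<And>f. f \<in> A \<Longrightarrow> f p = f q"
  shows "p = q"
proof -
  have "tent p \<in> A" using tent_mem[of "\<lambda>_. 1" p] by simp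
  from assms[OF this] show ?thesis by (simp add: tent_def max_def split: if_splits)
qed

end

lemma slow_lattice_SO:
  assumes "proper_metric TYPE('a::metric_space)"
  shows "slow_lattice (SO :: ('a \<Rightarrow> real) set)"
proof
  show "SO_bdd \<subseteq> (SO :: ('a \<Rightarrow> real) set)" by (auto simp: SO_bdd_def)
  show "(\<lambda>x. f x + g x) \<in> SO" if "f \<in> SO" "g \<in> SO" for f g :: "'a \<Rightarrow> real"
    by (rule SO_combine[OF assms that, where L = 1])
      (use that in \<open>auto dest!: SO_continuous intro!: continuous_intros\<close>)
  show "(\<lambda>x. max (f x) (g x)) \<in> SO" if "f \<in> SO" "g \<in> SO" for f g :: "'a \<Rightarrow> real"
    by (rule SO_combine[OF assms that, where L = 1])
      (use that in \<open>auto dest!: SO_continuous intro!: continuous_intros\<close>)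
  show "(\<lambda>x. min (f x) (g x)) \<in> SO" if "f \<in> SO" "g \<in> SO" for f g :: "'a \<Rightarrow> real"
    by (rule SO_combine[OF assms that, where L = 1])
      (use that in \<open>auto dest!: SO_continuous intro!: continuous_intros\<close>)
  show "(\<lambda>x. c * f x) \<in> SO" if "f \<in> SO" for c and f :: "'a \<Rightarrow> real"
  proof (rule SO_combine[OF assms that that, where L = "\<bar>c\<bar>"])
    show "\<bar>c * f x - c * f x'\<bar> \<le> \<bar>c\<bar> * (\<bar>f x - f x'\<bar> + \<bar>f x - f x'\<bar>)" for x x'
      by (simp add: abs_mult right_diff_distrib[symmetric] mult_left_mono)
  qed (use that in \<open>auto dest!: SO_continuous intro!: continuous_intros\<close>)
  show "\<exists>F\<in>SO. \<forall>n. \<exists>C. \<forall>x. real n * f x \<le> F x + C"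
    if "f \<in> SO" "\<And>x. 0 \<le> f x" for f :: "'a \<Rightarrow> real"
    by (rule SO_superlinear[OF assms that])
qed (rule assms subset_refl)+

lemma slow_lattice_SO_bdd:
  assumes "proper_metric TYPE('a::metric_space)"
  shows "slow_lattice (SO_bdd :: ('a \<Rightarrow> real) set)"
proof -
  interpret SO: slow_lattice "SO :: ('a \<Rightarrow> real) set" by (rule slow_lattice_SO[OF assms])
  have bdd_iff: "f \<in> SO_bdd \<longleftrightarrow> f \<in> SO \<and> (\<exists>M. \<forall>x. \<bar>f x\<bar> \<le> M)" for f :: "'a \<Rightarrow> real"
    by (simp add: SO_bdd_def bounded_range_real_iff)
  have combine: "h \<in> SO_bdd"
    if h: "h \<in> SO" and fg: "f \<in> SO_bdd" "g \<in> SO_bdd"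
      and le: "\<And>x. \<bar>h x\<bar> \<le> L * (\<bar>f x\<bar> + \<bar>g x\<bar>)" "0 \<le> L"
    for f g h :: "'a \<Rightarrow> real" and L
  proof -
    obtain M M' where M: "\<And>x. \<bar>f x\<bar> \<le> M" "\<And>x. \<bar>g x\<bar> \<le> M'" using fg bdd_iff by metis
    have "\<bar>h x\<bar> \<le> L * (M + M')" for x
      using le(1)[of x] mult_left_mono[OF add_mono[OF M(1)[of x] M(2)[of x]] le(2)] by linarith
    with h show ?thesis using bdd_iff by blast
  qed
  show ?thesis
  proof
    show "(\<lambda>x. f x + g x) \<in> SO_bdd" if "f \<in> SO_bdd" "g \<in> SO_bdd" for f g :: "'a \<Rightarrow> real"
      by (rule combine[OF SO.add_closed that, where L = 1]) (use that in \<open>auto simp: SO_bdd_def\<close>)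
    show "(\<lambda>x. max (f x) (g x)) \<in> SO_bdd" if "f \<in> SO_bdd" "g \<in> SO_bdd" for f g :: "'a \<Rightarrow> real"
      by (rule combine[OF SO.max_closed that, where L = 1]) (use that in \<open>auto simp: SO_bdd_def\<close>)
    show "(\<lambda>x. min (f x) (g x)) \<in> SO_bdd" if "f \<in> SO_bdd" "g \<in> SO_bdd" for f g :: "'a \<Rightarrow> real"
      by (rule combine[OF SO.min_closed that, where L = 1]) (use that in \<open>auto simp: SO_bdd_def\<close>)
    show "(\<lambda>x. c * f x) \<in> SO_bdd" if "f \<in> SO_bdd" for c and f :: "'a \<Rightarrow> real"
      by (rule combine[OF SO.scale_closed that that, where L = "\<bar>c\<bar>"])
        (use that in \<open>auto simp: SO_bdd_def abs_mult mult_left_mono\<close>)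
    show "\<exists>F\<in>SO_bdd. \<forall>n. \<exists>C. \<forall>x. real n * f x \<le> F x + C" if f: "f \<in> SO_bdd" for f :: "'a \<Rightarrow> real"
    proof (rule bexI[OF _ f], intro allI)
      fix n
      obtain M where M: "\<And>x. \<bar>f x\<bar> \<le> M" using f bdd_iff by blast
      \<comment> \<open>For bounded \<open>f\<close> the constant absorbs \<open>n f\<close>, so any \<open>F\<close> in the lattice will do.\<close>
      have "real n * f x \<le> f x + (real n * M + M)" for x
        using mult_left_mono[OF abs_le_D1[OF M[of x]], of "real n"] M[of x] by auto
      then show "\<exists>C. \<forall>x. real n * f x \<le> f x + C" by blast
    qed
    show "SO_bdd \<subseteq> (SO :: ('a \<Rightarrow> real) set)" by (auto simp: SO_bdd_def)
  qed (rule assms subset_refl)+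
qed

section \<open>Lattice isomorphisms are weighted compositions\<close>

locale slow_lattice_iso = dom: slow_lattice A + cod: slow_lattice B
  for A :: "('a::metric_space \<Rightarrow> real) set" and B :: "('b::metric_space \<Rightarrow> real) set" +
  fixes T
  assumes iso: "T \<in> linear_lattice_isos A B"
begin

lemma T_bij: "bij_betw T A B"
  using iso unfolding linear_lattice_isos_def by blast

lemma T_mem: "f \<in> A \<Longrightarrow> T f \<in> B"
  using T_bij by (auto simp: bij_betw_def)

lemma T_onto: "g \<in> B \<Longrightarrow> \<exists>f\<in>A. T f = g"
  using T_bij by (auto simp: bij_betw_def)

lemma T_eq_iff: "f \<in> A \<Longrightarrow> g \<in> A \<Longrightarrow> T f = T g \<longleftrightarrow> f = g"
  using T_bij by (auto simp: bij_betw_def inj_on_eq_iff)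

lemma T_add: "T (\<lambda>x. f x + g x) y = T f y + T g y" if "f \<in> A" "g \<in> A"
proof -
  have "T (\<lambda>x. f x + g x) = (\<lambda>y. T f y + T g y)"
    using iso that unfolding linear_lattice_isos_def by blast
  then show ?thesis by (rule fun_cong)
qed

lemma T_scale: "T (\<lambda>x. c * f x) y = c * T f y" if "f \<in> A"
proof -
  have "T (\<lambda>x. c * f x) = (\<lambda>y. c * T f y)"
    using iso that unfolding linear_lattice_isos_def by blast
  then show ?thesis by (rule fun_cong)
qed

lemma T_max: "T (\<lambda>x. max (f x) (g x)) y = max (T f y) (T g y)" if "f \<in> A" "g \<in> A"
proof -
  have "T (\<lambda>x. max (f x) (g x)) = (\<lambda>y. max (T f y) (T g y))"
    using iso that unfolding linear_lattice_isos_def by blast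
  then show ?thesis by (rule fun_cong)
qed

lemma T_min: "T (\<lambda>x. min (f x) (g x)) y = min (T f y) (T g y)" if "f \<in> A" "g \<in> A"
proof -
  have "T (\<lambda>x. min (f x) (g x)) = (\<lambda>y. min (T f y) (T g y))"
    using iso that unfolding linear_lattice_isos_def by blast
  then show ?thesis by (rule fun_cong)
qed

lemma T_diff: "T (\<lambda>x. f x - g x) y = T f y - T g y" if f: "f \<in> A" and g: "g \<in> A"
proof -
  have "T (\<lambda>x. f x - g x) y = T (\<lambda>x. f x + -1 * g x) y" by simp
  also have "\<dots> = T f y - T g y"
    unfolding T_add[OF f dom.scale_closed[OF g]] T_scale[OF g] by simp
  finally show ?thesis .
qed

text \<open>Order is expressed by \<open>max\<close>, so an injective lattice homomorphism reflects it.\<close>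

lemma T_le_iff:
  assumes f: "f \<in> A" and g: "g \<in> A"
  shows "(\<forall>y. T f y \<le> T g y) \<longleftrightarrow> (\<forall>x. f x \<le> g x)"
proof -
  have max_eq: "max a b = b \<longleftrightarrow> a \<le> b" for a b :: real by (auto simp: max_def)
  have "(\<forall>x. f x \<le> g x) \<longleftrightarrow> (\<lambda>x. max (f x) (g x)) = g"
    by (simp only: fun_eq_iff max_eq)
  also have "\<dots> \<longleftrightarrow> T (\<lambda>x. max (f x) (g x)) = T g"
    using T_eq_iff[OF dom.max_closed[OF f g] g] by simp
  also have "\<dots> \<longleftrightarrow> (\<forall>y. T f y \<le> T g y)"
    by (simp only: fun_eq_iff T_max[OF f g] max_eq)
  finally show ?thesis by simp
qed

lemma T_mono: "f \<in> A \<Longrightarrow> g \<in> A \<Longrightarrow> (\<And>x. f x \<le> g x) \<Longrightarrow> T f y \<le> T g y"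
  using T_le_iff by blast

definition weight where "weight = T (\<lambda>_. 1)"

lemma weight_mem: "weight \<in> B"
  by (simp add: weight_def T_mem dom.const_mem)

lemma T_const: "T (\<lambda>_. c) y = c * weight y"
  using T_scale[OF dom.const_mem[of 1], of c y] by (simp add: weight_def)

lemma T_nonneg: "f \<in> A \<Longrightarrow> (\<And>x. 0 \<le> f x) \<Longrightarrow> 0 \<le> T f y"
  using T_mono[OF dom.const_mem[of 0], of f y] T_const[of 0 y] by simp

lemma weight_pos: "0 < weight y"
proof (rule ccontr)
  assume "\<not> 0 < weight y"
  then have e0: "weight y = 0"
    using T_nonneg[OF dom.const_mem[of 1], of y] by (simp add: weight_def)
  obtain f where f: "f \<in> A" "T f = (\<lambda>_. 1)" using T_onto[OF cod.const_mem] by blast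
  have "\<forall>y. T (\<lambda>_. 0) y \<le> T f y" using T_const[of 0] by (simp add: f(2))
  then have "\<And>x. 0 \<le> f x" using T_le_iff[OF dom.const_mem f(1)] by simp
  with dom.superlinear_minorant[OF f(1)] obtain F where F: "F \<in> A"
    "\<And>n. \<exists>C. \<forall>x. real n * f x \<le> F x + C" by blast
  have "real n \<le> T F y" for n
  proof -
    obtain C where C: "\<And>x. real n * f x \<le> F x + C" using F(2) by blast
    have "T (\<lambda>x. real n * f x) y \<le> T (\<lambda>x. F x + C) y"
      by (intro T_mono dom.scale_closed dom.add_closed dom.const_mem f F C)
    then show ?thesis
      by (simp add: T_scale[OF f(1)] T_add[OF F(1) dom.const_mem] T_const e0 f(2))
  qed
  then show False using reals_Archimedean2[of "T F y"] by (meson not_le)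
qed

text \<open>The functional \<open>f \<mapsto> T f y\<close> is a multiple of a point evaluation. In terms of the Higson
  compactification, it is a lattice homomorphism and hence given by a point of the compactification;
  the task is to exclude the corona. This is done without the compactification, by looking at the
  preimage \<open>u\<close> of a function that peaks only at \<open>y\<close>.\<close>

lemma evaluation_point:
  shows "\<exists>x. \<forall>f\<in>A. T f y = weight y * f x"
proof -
  define h where "h z = weight z * tent y z" for z
  have "h \<in> B" unfolding h_def by (intro cod.tent_mem cod.continuous weight_mem)
  then obtain u where u: "u \<in> A" "T u = h" using T_onto by blast
  have weight_nz: "weight z \<noteq> 0" for z using weight_pos[of z] by simp
  have hy: "h y = weight y" by (simp add: h_def tent_def)
  have u_le: "u x \<le> 1" for x
  proof -
    have "h z \<le> weight z" for z using weight_pos[of z] by (simp add: h_def tent_def)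
    then have "\<forall>z. T u z \<le> T (\<lambda>_. 1) z" by (simp add: u(2) T_const)
    then show ?thesis using T_le_iff[OF u(1) dom.const_mem] by blast
  qed
  have u_sup: "\<exists>x. c < u x" if "c < 1" for c
  proof (rule ccontr)
    assume "\<nexists>x. c < u x"
    then have "T u y \<le> T (\<lambda>_. c) y" by (intro T_mono u dom.const_mem) (simp add: not_less)
    with that weight_pos[of y] show False by (simp add: u(2) T_const hy)
  qed
  \<comment> \<open>If the value at \<open>y\<close> were smaller, compactness of the unit ball would give \<open>c < 1\<close> with \<open>T a \<le> c * T 1\<close>.\<close>
  have peak: "weight y \<le> T a y"
    if a: "a \<in> A" "\<And>x. a x \<le> u x" and sup: "\<And>c. c < 1 \<Longrightarrow> \<exists>x. c < a x" for a
  proof (rule ccontr)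
    assume less: "\<not> weight y \<le> T a y"
    have Ta_le: "T a z \<le> h z" for z using T_mono[OF a(1) u(1) a(2)] u(2) by simp
    have "\<exists>z\<in>cball y 1. \<forall>z'\<in>cball y 1. T a z' / weight z' \<le> T a z / weight z"
      using cod.proper cod.continuous[OF T_mem[OF a(1)]] cod.continuous[OF weight_mem] weight_nz
      unfolding proper_metric_def
      by (intro continuous_attains_sup continuous_intros) (auto intro: continuous_on_subset)
    then obtain z where z: "\<And>z'. dist y z' \<le> 1 \<Longrightarrow> T a z' / weight z' \<le> T a z / weight z"
      unfolding Ball_def mem_cball by blast
    define c where "c = max 0 (T a z / weight z)"
    have "T a z / weight z < 1"
    proof (cases "z = y")
      case True
      with less weight_pos[of y] show ?thesis by simp
    next
      case False
      have "T a z / weight z \<le> tent y z" using Ta_le[of z] weight_pos[of z] by (simp add: h_def field_simps)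
      also have "\<dots> < 1" using False by (simp add: tent_def)
      finally show ?thesis .
    qed
    then have "c < 1" by (simp add: c_def)
    have "T a z' \<le> T (\<lambda>_. c) z'" for z'
    proof (cases "dist y z' \<le> 1")
      case True
      then have "T a z' / weight z' \<le> c" unfolding c_def by (intro max.coboundedI2 z)
      then show ?thesis using weight_pos[of z'] by (simp add: T_const field_simps)
    next
      case False
      then have "h z' = 0" by (simp add: h_def tent_def)
      then have "T a z' \<le> 0" using Ta_le[of z'] by simp
      also have "0 \<le> c * weight z'" using weight_pos[of z'] by (simp add: c_def)
      finally show ?thesis by (simp add: T_const)
    qed
    then have "a x \<le> c" for x using T_le_iff[OF a(1) dom.const_mem] by blast
    with sup[OF \<open>c < 1\<close>] show False by (meson not_le)
  qed
  \<comment> \<open>\<open>u\<close> does not approach \<open>1\<close> at infinity; otherwise \<open>f\<close> and \<open>1 - f\<close> below would both have full value at \<open>y\<close>.\<close>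
  have "\<exists>c<1. bounded {x. c \<le> u x}"
  proof (rule ccontr)
    assume no: "\<nexists>c. c < 1 \<and> bounded {x. c \<le> u x}"
    define \<delta> where "\<delta> n = 1 - 1 / real (Suc n)" for n
    have far: "\<exists>x. \<delta> n \<le> u x \<and> M \<le> dist p x" for n M and p :: 'a
    proof (rule ccontr)
      assume "\<nexists>x. \<delta> n \<le> u x \<and> M \<le> dist p x"
      then have "\<forall>x. \<delta> n \<le> u x \<longrightarrow> dist p x \<le> M" by (meson linear)
      then have "{x. \<delta> n \<le> u x} \<subseteq> cball p M" by auto
      then have "bounded {x. \<delta> n \<le> u x}" by (rule bounded_subset[OF bounded_cball])
      moreover have "\<delta> n < 1" by (simp add: \<delta>_def)
      ultimately show False using no by blast
    qed
    fix p :: 'a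
    have "\<exists>a b. (\<delta> n \<le> u a \<and> \<delta> n \<le> u b) \<and> M \<le> dist p a \<and> M \<le> dist p b \<and> M \<le> dist a b" for n M
    proof -
      obtain a where a: "\<delta> n \<le> u a" "M \<le> dist p a" using far by blast
      obtain b where b: "\<delta> n \<le> u b" "M + dist p a \<le> dist p b" using far by blast
      have "M \<le> dist a b" using b(2) dist_triangle[of p b a] by simp
      with a b zero_le_dist[of p a] show ?thesis
        by (intro exI[of _ a] exI[of _ b]) linarith
    qed
    from divergent_pairs_separation[OF dom.proper,
        where P = "\<lambda>n a b. \<delta> n \<le> u a \<and> \<delta> n \<le> u b", OF this] obtain f where f: "f \<in> SO_bdd"
      "\<And>n. \<exists>a b. (\<delta> n \<le> u a \<and> \<delta> n \<le> u b) \<and> f a = 0 \<and> f b = 1" by blast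
    have \<delta>: "\<exists>n. c < \<delta> n" if "c < 1" for c
    proof -
      have "0 < 1 - c" using that by simp
      then obtain n where "inverse (real (Suc n)) < 1 - c" using reals_Archimedean by blast
      then show ?thesis by (intro exI[of _ n]) (simp add: \<delta>_def divide_inverse)
    qed
    have fA: "f \<in> A" and f'A: "(\<lambda>x. 1 - f x) \<in> A"
      using f(1) by (auto intro: dom.diff_closed dom.const_mem dom.SO_bdd_mem)
    have lower: "weight y \<le> T g y" if g: "g \<in> A" "\<And>n. \<exists>x. \<delta> n \<le> u x \<and> g x = 1" for g
    proof -
      have "weight y \<le> T (\<lambda>x. min (g x) (u x)) y"
      proof (rule peak)
        fix c :: real assume "c < 1"
        with \<delta> obtain n where "c < \<delta> n" by blast
        moreover obtain x where "\<delta> n \<le> u x" "g x = 1" using g(2) by blast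
        ultimately show "\<exists>x. c < min (g x) (u x)" using \<open>c < 1\<close> by (intro exI[of _ x]) simp
      qed (auto intro: dom.min_closed g u)
      then show ?thesis by (simp add: T_min[OF g(1) u(1)])
    qed
    have "weight y \<le> T f y" by (rule lower[OF fA]) (use f(2) in blast)
    moreover have "weight y \<le> T (\<lambda>x. 1 - f x) y"
    proof (rule lower[OF f'A])
      show "\<exists>x. \<delta> n \<le> u x \<and> 1 - f x = 1" for n using f(2)[of n] by auto
    qed
    ultimately show False
      using weight_pos[of y] by (simp add: T_diff[OF dom.const_mem fA] T_const)
  qed
  then obtain c where c: "c < 1" "bounded {x. c \<le> u x}" by blast
  have ucont: "continuous_on UNIV u" by (rule dom.continuous[OF u(1)])
  then have "closed {x. c \<le> u x}"
    by (intro closed_Collect_le continuous_intros)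
  moreover obtain K where K: "compact K" "{x. c \<le> u x} \<subseteq> K"
    using bounded_imp_in_compact[OF dom.proper c(2)] by blast
  ultimately have "compact {x. c \<le> u x}" using compact_Int_closed[OF K(1)] by (metis inf.absorb_iff2)
  moreover have "{x. c \<le> u x} \<noteq> {}" using u_sup[OF c(1)] by (auto intro: less_imp_le)
  ultimately obtain x where x: "c \<le> u x" "\<And>x'. c \<le> u x' \<Longrightarrow> u x' \<le> u x"
    using continuous_attains_sup[of "{x. c \<le> u x}" u] continuous_on_subset[OF ucont] by auto
  have ux: "u x = 1"
  proof (rule ccontr)
    assume "u x \<noteq> 1"
    then have "u x < 1" using u_le[of x] by simp
    then obtain x' where "u x < u x'" using u_sup by blast
    with x show False by (meson less_le_not_le order_trans)
  qed
  \<comment> \<open>\<open>min u (1 - g)\<close> still attains \<open>1\<close> at \<open>x\<close>, so \<open>T (1 - g) y\<close> is as large as \<open>T 1 y\<close>.\<close>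
  have vanish: "T g y = 0" if g: "g \<in> A" "\<And>x. 0 \<le> g x" "g x = 0" for g
  proof -
    have g': "(\<lambda>x. 1 - g x) \<in> A" by (intro dom.diff_closed dom.const_mem g)
    have "weight y \<le> T (\<lambda>x. min (u x) (1 - g x)) y"
    proof (rule peak)
      fix c :: real assume "c < 1"
      then show "\<exists>x. c < min (u x) (1 - g x)" by (intro exI[of _ x]) (simp add: ux g)
    qed (auto intro: dom.min_closed g' u)
    also have "\<dots> \<le> weight y - T g y"
      by (simp add: T_min[OF u(1) g'] T_diff[OF dom.const_mem g(1)] T_const)
    finally show ?thesis using T_nonneg[OF g(1,2), of y] by simp
  qed
  have "T f y = weight y * f x" if f: "f \<in> A" for f
  proof -
    have p: "(\<lambda>z. f z - f x) \<in> A" "(\<lambda>z. f x - f z) \<in> A"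
      by (intro dom.diff_closed dom.const_mem f)+
    have "T (\<lambda>z. max (f z - f x) (f x - f z)) y = 0"
      by (rule vanish) (auto intro: dom.max_closed p)
    then have "max (T f y - f x * weight y) (f x * weight y - T f y) = 0"
      by (simp only: T_max[OF p] T_diff[OF f dom.const_mem] T_diff[OF dom.const_mem f] T_const)
    then show ?thesis by (simp add: max_def mult.commute split: if_splits)
  qed
  then show ?thesis by blast
qed

end

section \<open>Weights and coarseness\<close>

text \<open>The first point of a chain leading away from \<open>x\<close> that leaves the unit ball.\<close>

lemma chain_connected_step:
  assumes "r_chain_connected r TYPE('a::metric_space)" and "\<not> bounded (UNIV :: 'a set)"
  shows "\<exists>x'::'a. 1 < dist x x' \<and> dist x x' \<le> 1 + r"
proof -
  obtain z where z: "1 < dist x z"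
    using assms(2) unfolding bounded_def by (meson UNIV_I not_le)
  have "\<exists>n. \<exists>p::nat \<Rightarrow> 'a. p 0 = x \<and> p n = z \<and> (\<forall>i\<in>{1..n}. dist (p (i - 1)) (p i) \<le> r)"
    by (rule assms(1)[unfolded r_chain_connected_def, THEN spec, THEN spec])
  then obtain n and p :: "nat \<Rightarrow> 'a" where p: "p 0 = x" "p n = z"
    "\<forall>i\<in>{1..n}. dist (p (i - 1)) (p i) \<le> r" by (elim exE conjE)
  define i where "i = (LEAST i. 1 < dist x (p i))"
  have i: "1 < dist x (p i)" "i \<le> n"
    unfolding i_def by (rule LeastI[of _ n], simp add: z p(2)) (rule Least_le, simp add: z p(2))
  have "i \<noteq> 0" using i(1) p(1) by (intro notI) simp
  then have "\<not> 1 < dist x (p (i - 1))"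
    using not_less_Least[of "i - 1" "\<lambda>i. 1 < dist x (p i)"] unfolding i_def by simp
  moreover have "dist (p (i - 1)) (p i) \<le> r" using p(3) i(2) \<open>i \<noteq> 0\<close> by simp
  ultimately have "dist x (p i) \<le> 1 + r" using dist_triangle[of x "p i" "p (i - 1)"] by linarith
  with i(1) show ?thesis by blast
qed

text \<open>Suppose that \<open>e (y n) \<ge> n + 1\<close> along a sparse sequence. The function \<open>g\<close> has value at least \<open>1 / (n + 1)\<close>
  at \<open>y n\<close> and vanishes at distance \<open>1\<close> or more from all of these points. Then \<open>e * g\<close> is at least \<open>1\<close> at \<open>y n\<close> but
  zero at a neighbour of \<open>y n\<close> supplied by chain connectedness, arbitrarily far out.\<close>

lemma weight_bounded_above:
  fixes e :: "'a::metric_space \<Rightarrow> real"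
  assumes proper: "proper_metric TYPE('a)" and chain: "chain_connected TYPE('a)"
    and unbdd: "\<not> bounded (UNIV :: 'a set)" and cont: "continuous_on UNIV e"
    and mult: "\<And>g. continuous_on UNIV g \<Longrightarrow> (\<And>\<epsilon>. \<epsilon> > 0 \<Longrightarrow> bounded {x. \<epsilon> \<le> \<bar>g x\<bar>})
      \<Longrightarrow> (\<lambda>x. e x * g x) \<in> SO"
  shows "\<exists>M. \<forall>x. e x \<le> M"
proof (rule ccontr)
  assume unb: "\<nexists>M. \<forall>x. e x \<le> M"
  obtain r where "0 < r" "r_chain_connected r TYPE('a)"
    using chain unfolding chain_connected_def by blast
  note step = chain_connected_step[OF this(2) unbdd]
  fix p :: 'a
  have "\<exists>x. real n + 1 \<le> e x \<and> M \<le> dist p x" for n M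
  proof (rule ccontr)
    assume no: "\<nexists>x. real n + 1 \<le> e x \<and> M \<le> dist p x"
    have "compact (e ` cball p M)"
      using proper cont unfolding proper_metric_def
      by (meson compact_continuous_image continuous_on_subset subset_UNIV)
    then have "bounded (e ` cball p M)" by (rule compact_imp_bounded)
    then obtain C where C: "\<forall>x\<in>cball p M. \<bar>e x\<bar> \<le> C" by (auto simp: bounded_iff)
    have "e x \<le> max C (real n + 1)" for x
    proof (cases "dist p x \<le> M")
      case True
      with C have "\<bar>e x\<bar> \<le> C" by simp
      then show ?thesis by simp
    next
      case False
      then have "\<not> real n + 1 \<le> e x" using no by auto
      then show ?thesis by simp
    qed
    with unb show False by blast
  qed
  from sparse_sequence[where P = "\<lambda>n x. real n + 1 \<le> e x" and lo = "dist p"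
      and hi = "\<lambda>x. dist p x + 1 + r", OF this]
  obtain y where y_big: "\<And>n. real n + 1 \<le> e (y n)"
    and y_sparse: "\<And>m n. m < n \<Longrightarrow> dist p (y m) + 1 + r + real n + 1 \<le> dist p (y n)" by metis
  have y_far: "2 + r \<le> dist (y m) (y n)" if "m \<noteq> n" for m n
  proof -
    have "2 + r \<le> dist (y m) (y n)" if "m < n" for m n
      using y_sparse[OF that] dist_triangle[of p "y n" "y m"] by linarith
    with \<open>m \<noteq> n\<close> show ?thesis by (metis dist_commute linorder_neqE_nat)
  qed
  \<comment> \<open>\<open>D\<close> tends to infinity although \<open>D (y n) \<le> n\<close>: distances are taken in the product with the line,
    where the \<open>n\<close>-th point is lifted to height \<open>n\<close>.\<close>
  define D where "D x = infdist (x, 0 :: real) (range (\<lambda>n. (y n, real n)))" for x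
  have D_nonneg: "0 \<le> D x" for x by (simp add: D_def infdist_nonneg)
  have D_bdd: "bounded {x. D x \<le> R}" for R
  proof (rule bounded_subset)
    define N where "N = nat \<lceil>R + 1\<rceil>"
    show "bounded (\<Union>k\<in>{..N}. cball (y k) (R + 1))" by auto
    show "{x. D x \<le> R} \<subseteq> (\<Union>k\<in>{..N}. cball (y k) (R + 1))"
    proof
      fix x assume "x \<in> {x. D x \<le> R}"
      then have "infdist (x, 0) (range (\<lambda>n. (y n, real n))) \<le> R" by (simp add: D_def)
      then obtain v where "v \<in> range (\<lambda>n. (y n, real n))" "dist (x, 0) v < R + 1"
        by (rule infdist_le_obtains[rotated, where s = "R + 1"]) auto
      then obtain k where k: "dist (x, 0) (y k, real k) < R + 1" by blast
      have "dist x (y k) \<le> R + 1" using dist_fst_le[of "(x, 0::real)" "(y k, real k)"] k by simp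
      moreover have "real k \<le> R + 1" using dist_snd_le[of "(x, 0::real)" "(y k, real k)"] k by (simp add: dist_real_def)
      moreover from this have "k \<le> N" unfolding N_def by linarith
      ultimately show "x \<in> (\<Union>k\<in>{..N}. cball (y k) (R + 1))"
        by (auto simp: dist_commute intro!: bexI[of _ k])
    qed
  qed
  define g where "g x = max 0 (1 - infdist x (range y)) * (1 / (1 + D x))" for x
  have "(\<lambda>x. e x * g x) \<in> SO"
  proof (rule mult)
    have "continuous_on UNIV D" unfolding D_def by (intro continuous_intros)
    moreover have "1 + D x \<noteq> 0" for x using D_nonneg[of x] by linarith
    ultimately show "continuous_on UNIV g" unfolding g_def by (intro continuous_intros) auto
    fix \<epsilon> :: real assume "\<epsilon> > 0"
    have "{x. \<epsilon> \<le> \<bar>g x\<bar>} \<subseteq> {x. D x \<le> 1 / \<epsilon>}"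
    proof
      fix x assume "x \<in> {x. \<epsilon> \<le> \<bar>g x\<bar>}"
      then have "\<epsilon> \<le> \<bar>g x\<bar>" by simp
      also have "\<bar>g x\<bar> = max 0 (1 - infdist x (range y)) * (1 / (1 + D x))"
        using D_nonneg[of x] by (simp add: g_def)
      also have "\<dots> \<le> 1 * (1 / (1 + D x))"
        using D_nonneg[of x] infdist_nonneg[of x "range y"] by (intro mult_right_mono) auto
      finally have "\<epsilon> * (1 + D x) \<le> 1" using D_nonneg[of x] by (simp add: pos_le_divide_eq)
      with \<open>\<epsilon> > 0\<close> show "x \<in> {x. D x \<le> 1 / \<epsilon>}" by (simp add: field_simps)
    qed
    with D_bdd show "bounded {x. \<epsilon> \<le> \<bar>g x\<bar>}" by (meson bounded_subset)
  qed
  from SO_oscillation[OF proper this, of "1/2" "1 + r"] obtain K where K: "bounded K"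
    "\<And>x x'. x \<notin> K \<Longrightarrow> dist x x' \<le> 1 + r \<Longrightarrow> \<bar>e x * g x - e x' * g x'\<bar> \<le> 1/2" by auto
  obtain M where M: "\<And>x. x \<in> K \<Longrightarrow> dist p x \<le> M"
    using K(1) unfolding bounded_any_center[where a = p] by blast
  obtain n where n: "0 < n" "M < real n"
    using reals_Archimedean2[of "max M 0"] by (metis max_less_iff_conj of_nat_0_less_iff)
  have "y n \<notin> K"
    using M[of "y n"] y_sparse[OF n(1)] n(2) \<open>0 < r\<close> zero_le_dist[of p "y 0"] by linarith
  moreover obtain x' where x': "1 < dist (y n) x'" "dist (y n) x' \<le> 1 + r" using step by blast
  ultimately have small: "\<bar>e (y n) * g (y n) - e x' * g x'\<bar> \<le> 1/2" using K(2) by blast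
  have "1 \<le> dist x' (y m)" for m
  proof (cases "m = n")
    case True
    with x'(1) show ?thesis by (simp add: dist_commute)
  next
    case False
    then show ?thesis
      using y_far[of m n] dist_triangle2[of "y m" "y n" x'] x'(2) by (simp add: dist_commute)
  qed
  then have "1 \<le> infdist x' (range y)"
    by (simp add: infdist_notempty) (intro cINF_greatest; auto)
  then have "g x' = 0" by (simp add: g_def)
  moreover have "1 \<le> e (y n) * g (y n)"
  proof -
    have "D (y n) \<le> dist (y n, 0) (y n, real n)" unfolding D_def by (intro infdist_le) auto
    then have "D (y n) \<le> real n" by (simp add: dist_Pair_Pair)
    then have "1 + D (y n) \<le> e (y n)" using y_big[of n] by linarith
    then show ?thesis using D_nonneg[of "y n"] by (simp add: g_def)
  qed
  ultimately show False using small by simp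
qed

lemma SO_comp_coarse:
  fixes f :: "'b::metric_space \<Rightarrow> real" and h :: "'a::metric_space \<Rightarrow> 'b"
  assumes "proper_metric TYPE('a)" "proper_metric TYPE('b)"
    and f: "f \<in> SO" and h: "continuous_on UNIV h" "coarse_map h"
  shows "(\<lambda>x. f (h x)) \<in> SO"
  unfolding SO_iff[OF assms(1)]
proof (intro conjI allI impI)
  show "continuous_on UNIV (\<lambda>x. f (h x))"
    by (rule continuous_on_compose2[OF SO_continuous[OF f] h(1)]) simp
  fix R \<epsilon> :: real assume "\<epsilon> > 0"
  obtain \<sigma> where \<sigma>: "mono_on {0..} \<sigma>" "\<And>x x'. dist (h x) (h x') \<le> \<sigma> (dist x x')"
    using h(2) unfolding coarse_map_def uniformly_expansive_def by blast
  from SO_oscillation[OF assms(2) f \<open>\<epsilon> > 0\<close>] obtain K where K: "bounded K"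
    "\<And>z z'. z \<notin> K \<Longrightarrow> dist z z' \<le> \<sigma> (max 0 R) \<Longrightarrow> \<bar>f z - f z'\<bar> \<le> \<epsilon>" by blast
  have "\<bar>f (h x) - f (h x')\<bar> \<le> \<epsilon>" if "x \<notin> h -` K" "dist x x' \<le> R" for x x'
  proof (rule K(2))
    show "h x \<notin> K" using that(1) by simp
    have "\<sigma> (dist x x') \<le> \<sigma> (max 0 R)" using that(2) by (intro mono_onD[OF \<sigma>(1)]) auto
    with \<sigma>(2)[of x x'] show "dist (h x) (h x') \<le> \<sigma> (max 0 R)" by linarith
  qed
  moreover have "bounded (h -` K)"
    using h(2) K(1) unfolding coarse_map_def metrically_proper_def by blast
  ultimately show "\<exists>K. bounded K \<and> (\<forall>x x'. x \<notin> K \<longrightarrow> dist x x' \<le> R \<longrightarrow> \<bar>f (h x) - f (h x')\<bar> \<le> \<epsilon>)"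
    by blast
qed

lemma uniformly_expansiveI:
  fixes s :: "'a::metric_space \<Rightarrow> 'b::metric_space"
  assumes "\<And>R. \<exists>M. \<forall>x x'. dist x x' \<le> R \<longrightarrow> dist (s x) (s x') \<le> M"
  shows "uniformly_expansive s"
proof -
  obtain M where M: "\<And>R x x'. dist x x' \<le> R \<Longrightarrow> dist (s x) (s x') \<le> M R" using assms by metis
  \<comment> \<open>Summing the bounds for integral distances makes the control function monotone.\<close>
  define \<sigma> where "\<sigma> R = (\<Sum>k\<le>nat \<lceil>R\<rceil>. \<bar>M (real k)\<bar>)" for R :: real
  have "dist (s x) (s x') \<le> \<sigma> (dist x x')" for x x'
  proof -
    define N where "N = nat \<lceil>dist x x'\<rceil>"
    have "dist (s x) (s x') \<le> M (real N)" by (rule M) (simp add: N_def)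
    also have "\<dots> \<le> \<bar>M (real N)\<bar>" by simp
    also have "\<dots> \<le> \<sigma> (dist x x')" unfolding \<sigma>_def N_def[symmetric] by (intro member_le_sum) auto
    finally show ?thesis .
  qed
  moreover have "mono_on {0..} \<sigma>"
  proof (rule mono_onI)
    fix R S :: real assume "R \<le> S"
    then have "nat \<lceil>R\<rceil> \<le> nat \<lceil>S\<rceil>" by (intro nat_mono ceiling_mono)
    then show "\<sigma> R \<le> \<sigma> S" unfolding \<sigma>_def by (intro sum_mono2) auto
  qed
  moreover have "\<sigma> \<in> {0..} \<rightarrow> {0..}" by (auto simp: \<sigma>_def intro: sum_nonneg)
  ultimately show ?thesis unfolding uniformly_expansive_def by blast
qed

text \<open>If points at distance at most \<open>R\<close> can be moved arbitrarily far apart, this happens arbitrarily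
  far out, because \<open>s\<close> is bounded on bounded sets. Such image pairs are separated by a slowly
  oscillating function, whose pullback then jumps by \<open>1\<close> within distance \<open>R\<close> at infinity.\<close>

lemma uniformly_expansive_if_pullback_SO:
  fixes s :: "'a::metric_space \<Rightarrow> 'b::metric_space"
  assumes proper: "proper_metric TYPE('a)" "proper_metric TYPE('b)"
    and cont: "continuous_on UNIV s" and mproper: "metrically_proper s"
    and pull: "\<And>f. f \<in> SO_bdd \<Longrightarrow> (\<lambda>x. f (s x)) \<in> SO"
  shows "uniformly_expansive s"
proof (rule uniformly_expansiveI, rule ccontr)
  fix R
  assume no: "\<nexists>M. \<forall>x x'. dist x x' \<le> R \<longrightarrow> dist (s x) (s x') \<le> M"
  fix p :: 'a
  let ?P = "\<lambda>n a b. \<exists>x x'. a = s x \<and> b = s x' \<and> dist x x' \<le> R \<and> real n \<le> dist p x"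
  have "\<exists>a b. ?P n a b \<and> M \<le> dist (s p) a \<and> M \<le> dist (s p) b \<and> M \<le> dist a b" for n M
  proof -
    \<comment> \<open>Points of \<open>D\<close> and their neighbours have boundedly distant images, so a badly stretched pair avoids \<open>D\<close>.\<close>
    define D where "D = cball p (real n) \<union> s -` cball (s p) M"
    define D' where "D' = {x. \<exists>x'\<in>D. dist x x' \<le> max 0 R}"
    have "bounded (s -` cball (s p) M)"
      using mproper bounded_cball unfolding metrically_proper_def by blast
    then have "bounded D" by (simp add: D_def)
    then have "bounded D'" unfolding D'_def by (rule bounded_neighbourhood)
    then obtain K where K: "compact K" "D' \<subseteq> K" using bounded_imp_in_compact[OF proper(1)] by blast
    have "compact (s ` K)" using K(1) cont
      by (meson compact_continuous_image continuous_on_subset subset_UNIV)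
    then have "bounded (s ` K)" by (rule compact_imp_bounded)
    then obtain M' where M': "\<forall>u\<in>s ` K. \<forall>v\<in>s ` K. dist u v \<le> M'"
      unfolding bounded_two_points by (rule exE)
    obtain x x' where x: "dist x x' \<le> R" "\<not> dist (s x) (s x') \<le> max M M'" using no by blast
    have "x \<notin> D \<and> x' \<notin> D"
    proof (rule ccontr)
      assume "\<not> (x \<notin> D \<and> x' \<notin> D)"
      then have "x \<in> D'" "x' \<in> D'"
        using x(1) by (auto simp: D'_def dist_commute intro: bexI[of _ x] bexI[of _ x'])
      then have "dist (s x) (s x') \<le> M'" using K(2) M' by blast
      with x(2) show False by simp
    qed
    then have "real n \<le> dist p x" "M \<le> dist (s p) (s x)" "M \<le> dist (s p) (s x')"
      by (auto simp: D_def)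
    moreover have "M \<le> dist (s x) (s x')" using x(2) by simp
    ultimately show ?thesis
      using x(1) by (intro exI[of _ "s x"] exI[of _ "s x'"] conjI exI[of _ x] exI[of _ x']) simp_all
  qed
  \<comment> \<open>The images of these close pairs diverge; a function separating them contradicts \<open>pull\<close>.\<close>
  from divergent_pairs_separation[OF proper(2), where P = ?P, OF this]
  obtain f where f: "f \<in> SO_bdd" "\<And>n. \<exists>a b. ?P n a b \<and> f a = 0 \<and> f b = 1" by metis
  from SO_oscillation[OF proper(1) pull[OF f(1)], of "1/2" R] obtain K where K: "bounded K"
    "\<And>x x'. x \<notin> K \<Longrightarrow> dist x x' \<le> R \<Longrightarrow> \<bar>f (s x) - f (s x')\<bar> \<le> 1/2" by auto
  obtain M where M: "\<And>x. x \<in> K \<Longrightarrow> dist p x \<le> M"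
    using K(1) unfolding bounded_any_center[where a = p] by blast
  obtain n where n: "M < real n" using reals_Archimedean2 by blast
  obtain x x' where x: "dist x x' \<le> R" "real n \<le> dist p x" "f (s x) = 0" "f (s x') = 1"
    using f(2)[of n] by blast
  have "x \<notin> K" using M[of x] n x(2) by linarith
  from K(2)[OF this x(1)] show False by (simp add: x)
qed

context slow_lattice_iso
begin

definition point_map :: "'b \<Rightarrow> 'a" where "point_map y = (SOME x. \<forall>f\<in>A. T f y = weight y * f x)"

lemma T_eq: "f \<in> A \<Longrightarrow> T f y = weight y * f (point_map y)"
  unfolding point_map_def using someI_ex[OF evaluation_point[of y]] by blast

lemma pullback_eq: "f \<in> A \<Longrightarrow> f (point_map y) = T f y / weight y"
  using T_eq[of f y] weight_pos[of y] by simp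

text \<open>The topology of the domain is detected by its function lattice: the map is continuous because
  its compositions with tents are.\<close>

lemma continuous_point_map: "continuous_on UNIV point_map"
proof (intro continuous_at_imp_continuous_on ballI)
  fix y
  let ?f = "\<lambda>x. 1 - tent (point_map y) x"
  have "?f \<in> A" using dom.diff_closed[OF dom.const_mem dom.tent_mem[of "\<lambda>_. 1" "point_map y"]] by simp
  note eq = pullback_eq[OF this]
  have "continuous_on UNIV (\<lambda>y'. T ?f y' / weight y')"
    using weight_pos by (intro continuous_intros cod.continuous T_mem \<open>?f \<in> A\<close> weight_mem) (metis less_irrefl)
  then have "continuous_on UNIV (\<lambda>y'. ?f (point_map y'))" by (simp only: eq)
  then have lim: "((\<lambda>y'. ?f (point_map y')) \<longlongrightarrow> ?f (point_map y)) (at y)"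
    by (simp add: continuous_on_eq_continuous_at isCont_def)
  show "isCont point_map y" unfolding isCont_def
  proof (rule tendstoI)
    fix \<epsilon> :: real assume "\<epsilon> > 0"
    then have "?f (point_map y) < min \<epsilon> 1" by (simp add: tent_def)
    from order_tendstoD(2)[OF lim this] show "\<forall>\<^sub>F y' in at y. dist (point_map y') (point_map y) < \<epsilon>"
      by eventually_elim (auto simp: tent_def dist_commute)
  qed
qed

lemma inverse_iso: "slow_lattice_iso B A (restrict (inv_into A T) B)"
proof
  let ?S = "restrict (inv_into A T) B"
  have S_mem: "?S g \<in> A" and TS: "T (?S g) = g" if "g \<in> B" for g
    using that T_bij by (auto simp: bij_betw_def inv_into_into f_inv_into_f)
  have S_eq: "?S g = f" if "f \<in> A" "T f = g" for f g
    using that T_mem[OF that(1)] bij_betw_inv_into_left[OF T_bij that(1)] by simp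
  have "bij_betw ?S B A"
    using bij_betw_inv_into[OF T_bij] by (rule bij_betw_cong[THEN iffD1, rotated]) simp
  then show "?S \<in> linear_lattice_isos B A"
    unfolding linear_lattice_isos_def
  proof (intro CollectI conjI ballI allI restrict_extensional)
    fix g h assume "g \<in> B" "h \<in> B"
    then show "?S (\<lambda>x. g x + h x) = (\<lambda>y. ?S g y + ?S h y)"
      by (intro S_eq ext dom.add_closed S_mem) (simp_all only: T_add[OF S_mem S_mem] TS)
    from \<open>g \<in> B\<close> \<open>h \<in> B\<close> show "?S (\<lambda>x. max (g x) (h x)) = (\<lambda>y. max (?S g y) (?S h y))"
      by (intro S_eq ext dom.max_closed S_mem) (simp_all only: T_max[OF S_mem S_mem] TS)
    from \<open>g \<in> B\<close> \<open>h \<in> B\<close> show "?S (\<lambda>x. min (g x) (h x)) = (\<lambda>y. min (?S g y) (?S h y))"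
      by (intro S_eq ext dom.min_closed S_mem) (simp_all only: T_min[OF S_mem S_mem] TS)
  next
    fix c g assume "g \<in> B"
    then show "?S (\<lambda>x. c * g x) = (\<lambda>y. c * ?S g y)"
      by (intro S_eq ext dom.scale_closed S_mem) (simp_all only: T_scale[OF S_mem] TS)
  qed
qed

end

text \<open>An isomorphism together with its inverse, so that facts about one can be transported to the
  other by exchanging their roles.\<close>

locale slow_lattice_inverse_isos =
  fwd: slow_lattice_iso A B T + bwd: slow_lattice_iso B A T'
  for A :: "('a::metric_space \<Rightarrow> real) set" and B :: "('b::metric_space \<Rightarrow> real) set" and T T' +
  assumes T'T: "f \<in> A \<Longrightarrow> T' (T f) = f" and TT': "g \<in> B \<Longrightarrow> T (T' g) = g"
begin

lemma flip: "slow_lattice_inverse_isos B A T' T"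
  by unfold_locales (fact T'T TT')+

lemma composite:
  "f \<in> A \<Longrightarrow> f x = bwd.weight x * fwd.weight (bwd.point_map x) * f (fwd.point_map (bwd.point_map x))"
  using bwd.T_eq[OF fwd.T_mem, of f x] fwd.T_eq[of f "bwd.point_map x"] T'T by simp

lemma weight_product: "bwd.weight x * fwd.weight (bwd.point_map x) = 1"
  using composite[OF fwd.dom.const_mem[of 1], of x] by simp

lemma point_map_inverse: "fwd.point_map (bwd.point_map x) = x"
proof (rule fwd.dom.separates_points)
  fix f assume "f \<in> A"
  then show "f (fwd.point_map (bwd.point_map x)) = f x" using composite[of f x] weight_product[of x] by simp
qed

text \<open>A function \<open>g\<close> vanishing at infinity on \<open>X\<close> stays so when moved to \<open>Y\<close>, and \<open>T'\<close> sends the result to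
  \<open>g\<close> times the weight of \<open>T'\<close>.\<close>

lemma weight_bounded:
  assumes "chain_connected TYPE('a)" "\<not> bounded (UNIV :: 'a set)"
  shows "\<exists>M. \<forall>x. bwd.weight x \<le> M"
proof (rule weight_bounded_above[OF fwd.dom.proper assms fwd.dom.continuous[OF bwd.weight_mem]])
  fix g :: "'a \<Rightarrow> real"
  assume g: "continuous_on UNIV g" "\<And>\<epsilon>. \<epsilon> > 0 \<Longrightarrow> bounded {x. \<epsilon> \<le> \<bar>g x\<bar>}"
  have gB: "(\<lambda>y. g (fwd.point_map y)) \<in> B"
  proof (intro fwd.cod.SO_bdd_mem vanishing_at_infinity_SO_bdd fwd.cod.proper)
    show "continuous_on UNIV (\<lambda>y. g (fwd.point_map y))"
      by (rule continuous_on_compose2[OF g(1) fwd.continuous_point_map]) simp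
    fix \<epsilon> :: real assume "\<epsilon> > 0"
    obtain K where K: "compact K" "{x. \<epsilon> \<le> \<bar>g x\<bar>} \<subseteq> K"
      using bounded_imp_in_compact[OF fwd.dom.proper g(2)[OF \<open>\<epsilon> > 0\<close>]] by blast
    have "y \<in> bwd.point_map ` K" if "\<epsilon> \<le> \<bar>g (fwd.point_map y)\<bar>" for y
      using K(2) that slow_lattice_inverse_isos.point_map_inverse[OF flip, of y] by (intro image_eqI) auto
    then have "{y. \<epsilon> \<le> \<bar>g (fwd.point_map y)\<bar>} \<subseteq> bwd.point_map ` K" by blast
    moreover have "compact (bwd.point_map ` K)"
      using K(1) bwd.continuous_point_map by (meson compact_continuous_image continuous_on_subset subset_UNIV)
    ultimately show "bounded {y. \<epsilon> \<le> \<bar>g (fwd.point_map y)\<bar>}" by (meson bounded_subset compact_imp_bounded)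
  qed
  have "T' (\<lambda>y. g (fwd.point_map y)) = (\<lambda>x. bwd.weight x * g x)"
    by (rule ext) (simp add: bwd.T_eq[OF gB] point_map_inverse)
  with bwd.T_mem[OF gB] have "(\<lambda>x. bwd.weight x * g x) \<in> A" by simp
  then show "(\<lambda>x. bwd.weight x * g x) \<in> SO" using fwd.dom.subset_SO by blast
qed

lemma metrically_proper_point_map: "metrically_proper fwd.point_map"
  unfolding metrically_proper_def
proof (intro allI impI)
  fix S :: "'a set" assume "bounded S"
  then obtain K where K: "compact K" "S \<subseteq> K" using bounded_imp_in_compact[OF fwd.dom.proper] by blast
  have "y \<in> bwd.point_map ` K" if "fwd.point_map y \<in> S" for y
    using K(2) that slow_lattice_inverse_isos.point_map_inverse[OF flip, of y] by (intro image_eqI) auto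
  then have "fwd.point_map -` S \<subseteq> bwd.point_map ` K" by blast
  moreover have "compact (bwd.point_map ` K)"
    using K(1) bwd.continuous_point_map by (meson compact_continuous_image continuous_on_subset subset_UNIV)
  ultimately show "bounded (fwd.point_map -` S)" by (meson bounded_subset compact_imp_bounded)
qed

text \<open>The pullback of \<open>f\<close> is \<open>T f\<close> divided by the weight, and the reciprocal of the weight is bounded,
  being the weight of the inverse isomorphism. A quotient of slowly oscillating functions with
  bounded value and bounded reciprocal denominator oscillates slowly.\<close>

lemma coarse_point_map:
  assumes "chain_connected TYPE('a)" "\<not> bounded (UNIV :: 'a set)"
  shows "coarse_map fwd.point_map"
  unfolding coarse_map_def
proof (intro conjI metrically_proper_point_map uniformly_expansive_if_pullback_SO
    fwd.dom.proper fwd.cod.proper fwd.continuous_point_map)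
  fix f :: "'a \<Rightarrow> real" assume "f \<in> SO_bdd"
  then have f: "f \<in> A" "continuous_on UNIV f" using fwd.dom.SO_bdd_mem fwd.dom.continuous by auto
  obtain H where H: "\<And>x. \<bar>f x\<bar> \<le> H"
    using \<open>f \<in> SO_bdd\<close> unfolding SO_bdd_def bounded_range_real_iff by blast
  obtain M where M: "\<And>x. bwd.weight x \<le> M" using weight_bounded[OF assms] by blast
  have M_pos: "0 < M" using M bwd.weight_pos by (meson less_le_trans)
  have inv_weight: "1 / fwd.weight y \<le> M" for y
  proof -
    have "bwd.weight (fwd.point_map y) * fwd.weight y = 1"
      using weight_product[of "fwd.point_map y"] slow_lattice_inverse_isos.point_map_inverse[OF flip, of y] by simp
    then have "1 / fwd.weight y = bwd.weight (fwd.point_map y)" using fwd.weight_pos[of y] by (simp add: field_simps)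
    then show ?thesis using M by simp
  qed
  show "(\<lambda>y. f (fwd.point_map y)) \<in> SO"
  proof (rule SO_combine[OF fwd.cod.proper, where f = "T f" and g = fwd.weight and L = "M * (1 + H)"])
    show "T f \<in> SO" "fwd.weight \<in> SO" using fwd.T_mem[OF f(1)] fwd.weight_mem fwd.cod.subset_SO by auto
    show "continuous_on UNIV (\<lambda>y. f (fwd.point_map y))"
      by (rule continuous_on_compose2[OF f(2) fwd.continuous_point_map]) simp
    fix y y'
    let ?a = "\<bar>T f y - T f y'\<bar>" and ?b = "\<bar>fwd.weight y - fwd.weight y'\<bar>" and ?h = "\<lambda>y. f (fwd.point_map y)"
    have "0 \<le> H" using H[of "fwd.point_map y"] by linarith
    have "?h y - ?h y' = (1 / fwd.weight y) * ((T f y - T f y') - ?h y' * (fwd.weight y - fwd.weight y'))"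
      using fwd.weight_pos[of y] by (simp add: fwd.T_eq[OF f(1)] field_simps)
    then have "\<bar>?h y - ?h y'\<bar> = (1 / fwd.weight y) * \<bar>(T f y - T f y') - ?h y' * (fwd.weight y - fwd.weight y')\<bar>"
      using fwd.weight_pos[of y] by (simp add: abs_mult)
    also have "\<dots> \<le> M * (?a + H * ?b)"
    proof (intro mult_mono inv_weight)
      have "\<bar>?h y' * (fwd.weight y - fwd.weight y')\<bar> \<le> H * ?b" unfolding abs_mult by (intro mult_right_mono H) simp
      then show "\<bar>(T f y - T f y') - ?h y' * (fwd.weight y - fwd.weight y')\<bar> \<le> ?a + H * ?b" by linarith
    qed (use M_pos in auto)
    also have "\<dots> \<le> M * ((1 + H) * (?a + ?b))"
    proof (rule mult_left_mono)
      show "?a + H * ?b \<le> (1 + H) * (?a + ?b)"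
        using mult_nonneg_nonneg[OF \<open>0 \<le> H\<close>, of ?a] by (simp add: distrib_left distrib_right)
    qed (use M_pos in simp)
    finally show "\<bar>?h y - ?h y'\<bar> \<le> M * (1 + H) * (?a + ?b)" by (simp add: mult.assoc)
  qed
qed

end

section \<open>The bijection\<close>

text \<open>For \<^const>\<open>SO\<close> and \<^const>\<open>SO_bdd\<close> this gives \<^const>\<open>SO_sharp\<close> and \<^const>\<open>SO_sharp_bdd\<close>.\<close>

definition multipliers :: "('b::metric_space \<Rightarrow> real) set \<Rightarrow> ('b \<Rightarrow> real) set" where
  "multipliers B = {\<omega> \<in> B. (\<forall>y. \<omega> y > 0) \<and>
     (\<forall>f\<in>B. (\<lambda>y. \<omega> y * f y) \<in> B \<and> (\<lambda>y. (1 / \<omega> y) * f y) \<in> B)}"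

locale slow_lattice_pair = dom: slow_lattice A + cod: slow_lattice B
  for A :: "('a::metric_space \<Rightarrow> real) set" and B :: "('b::metric_space \<Rightarrow> real) set" +
  assumes pull_A: "f \<in> A \<Longrightarrow> continuous_on UNIV h \<Longrightarrow> coarse_map h \<Longrightarrow> (\<lambda>y. f (h y)) \<in> B"
    and pull_B: "g \<in> B \<Longrightarrow> continuous_on UNIV k \<Longrightarrow> coarse_map k \<Longrightarrow> (\<lambda>x. g (k x)) \<in> A"
begin

lemma weighted_comp_iso:
  assumes \<omega>: "\<omega> \<in> multipliers B" and \<tau>: "\<tau> \<in> coarse_homeomorphisms"
  shows "weighted_comp A (\<omega>, \<tau>) \<in> linear_lattice_isos A B"
proof -
  let ?T = "weighted_comp A (\<omega>, \<tau>)"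
  have hom: "homeomorphism UNIV UNIV \<tau> (inv \<tau>)" and coarse: "coarse_map \<tau>" "coarse_map (inv \<tau>)"
    using \<tau> by (simp_all add: coarse_homeomorphisms_def)
  have cont: "continuous_on UNIV \<tau>" "continuous_on UNIV (inv \<tau>)"
    and inverse: "\<And>x. inv \<tau> (\<tau> x) = x" "\<And>y. \<tau> (inv \<tau> y) = y"
    using hom by (simp_all add: homeomorphism_def)
  have pos: "\<And>y. \<omega> y > 0"
    and mult: "\<And>g. g \<in> B \<Longrightarrow> (\<lambda>y. \<omega> y * g y) \<in> B" "\<And>g. g \<in> B \<Longrightarrow> (\<lambda>y. (1 / \<omega> y) * g y) \<in> B"
    using \<omega> by (simp_all add: multipliers_def)
  have T: "?T f = (\<lambda>y. \<omega> y * f (inv \<tau> y))" if "f \<in> A" for f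
    using that by (simp add: weighted_comp_def)
  have T_mem: "?T f \<in> B" if "f \<in> A" for f
    unfolding T[OF that] by (intro mult(1) pull_A[OF that] cont coarse)
  have "bij_betw ?T A B"
  proof (rule bij_betw_byWitness[where f' = "\<lambda>g x. (1 / \<omega> (\<tau> x)) * g (\<tau> x)"])
    have nz: "\<omega> y \<noteq> 0" for y using pos[of y] by simp
    show "\<forall>f\<in>A. (\<lambda>x. (1 / \<omega> (\<tau> x)) * ?T f (\<tau> x)) = f"
      by (simp add: T inverse nz)
    have S_mem: "(\<lambda>x. (1 / \<omega> (\<tau> x)) * g (\<tau> x)) \<in> A" if "g \<in> B" for g
      by (rule pull_B[OF mult(2)[OF that] cont(1) coarse(1)])
    show "\<forall>g\<in>B. ?T (\<lambda>x. (1 / \<omega> (\<tau> x)) * g (\<tau> x)) = g"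
    proof
      fix g assume "g \<in> B"
      from T[OF S_mem[OF this]] show "?T (\<lambda>x. (1 / \<omega> (\<tau> x)) * g (\<tau> x)) = g"
        by (simp only: inverse) (simp add: nz)
    qed
    show "?T ` A \<subseteq> B" using T_mem by blast
    show "(\<lambda>g x. (1 / \<omega> (\<tau> x)) * g (\<tau> x)) ` B \<subseteq> A" using S_mem by blast
  qed
  moreover have "?T \<in> extensional A" by (simp add: weighted_comp_def)
  ultimately show ?thesis
    unfolding linear_lattice_isos_def
  proof (intro CollectI conjI ballI allI)
    fix f g assume fg: "f \<in> A" "g \<in> A"
    note T' = T[OF fg(1)] T[OF fg(2)]
    show "?T (\<lambda>x. f x + g x) = (\<lambda>y. ?T f y + ?T g y)"
      unfolding T' T[OF dom.add_closed[OF fg]] by (simp add: distrib_left)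
    have "max (\<omega> y * a) (\<omega> y * b) = \<omega> y * max a b" "min (\<omega> y * a) (\<omega> y * b) = \<omega> y * min a b" for y a b
      using pos[of y] by (auto simp: max_def min_def)
    then show "?T (\<lambda>x. max (f x) (g x)) = (\<lambda>y. max (?T f y) (?T g y))"
      "?T (\<lambda>x. min (f x) (g x)) = (\<lambda>y. min (?T f y) (?T g y))"
      unfolding T' T[OF dom.max_closed[OF fg]] T[OF dom.min_closed[OF fg]] by simp_all
  next
    fix c f assume f: "f \<in> A"
    show "?T (\<lambda>x. c * f x) = (\<lambda>y. c * ?T f y)"
      unfolding T[OF f] T[OF dom.scale_closed[OF f]] by (simp add: mult.left_commute)
  qed
qed

lemma weighted_comp_inj:
  "inj_on (weighted_comp A) (multipliers B \<times> (coarse_homeomorphisms :: ('a \<Rightarrow> 'b) set))"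
proof (intro inj_onI, clarify)
  fix \<omega> \<omega>' and \<tau> \<tau>' :: "'a \<Rightarrow> 'b"
  assume mem: "\<omega> \<in> multipliers B" "\<tau> \<in> coarse_homeomorphisms" "\<tau>' \<in> coarse_homeomorphisms"
    and eq: "weighted_comp A (\<omega>, \<tau>) = weighted_comp A (\<omega>', \<tau>')"
  have eq: "\<omega> y * f (inv \<tau> y) = \<omega>' y * f (inv \<tau>' y)" if "f \<in> A" for f y
    using fun_cong[OF fun_cong[OF eq, of f], of y] that by (simp add: weighted_comp_def)
  have \<omega>: "\<omega> = \<omega>'" using eq[OF dom.const_mem[of 1]] by auto
  have "\<omega>' y \<noteq> 0" for y using mem(1) by (auto simp: \<omega> multipliers_def dest: spec[of _ y])
  then have "inv \<tau> y = inv \<tau>' y" for y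
    by (intro dom.separates_points) (use eq[of _ y] in \<open>simp add: \<omega>\<close>)
  then have "inv \<tau> = inv \<tau>'" by blast
  moreover have "\<tau> x = \<tau>' x" if "inv \<tau> = inv \<tau>'" for x
    using mem(2,3) that unfolding coarse_homeomorphisms_def homeomorphism_def
    by (metis (mono_tags, lifting) UNIV_I mem_Collect_eq)
  ultimately show "\<omega> = \<omega>' \<and> \<tau> = \<tau>'" using \<omega> by blast
qed

text \<open>The multiplier property comes for free: composing a function on \<open>Y\<close> with the coarse
  homeomorphism and applying \<open>T\<close> multiplies it by the weight, and applying \<open>T\<^sup>-\<^sup>1\<close> and composing back
  divides it by the weight.\<close>

lemma weighted_comp_surj:
  assumes "chain_connected TYPE('a)" "\<not> bounded (UNIV :: 'a set)"
    and "chain_connected TYPE('b)" "\<not> bounded (UNIV :: 'b set)"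
    and "T \<in> linear_lattice_isos A B"
  shows "\<exists>\<omega>\<in>multipliers B. \<exists>\<tau>\<in>coarse_homeomorphisms. weighted_comp A (\<omega>, \<tau>) = T"
proof -
  interpret fwd: slow_lattice_iso A B T by unfold_locales fact
  let ?T' = "restrict (inv_into A T) B"
  interpret bwd: slow_lattice_iso B A ?T' by (rule fwd.inverse_iso)
  interpret fb: slow_lattice_inverse_isos A B T ?T'
    using fwd.T_bij fwd.T_mem
    by unfold_locales (auto simp: bij_betw_def inv_into_f_f f_inv_into_f)
  interpret bf: slow_lattice_inverse_isos B A ?T' T by (rule fb.flip)
  have inv: "inv bwd.point_map = fwd.point_map"
    by (rule inv_unique_comp) (auto simp: fun_eq_iff fb.point_map_inverse bf.point_map_inverse)
  have coarse: "coarse_map fwd.point_map" "coarse_map bwd.point_map"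
    using fb.coarse_point_map bf.coarse_point_map assms by blast+
  have "bwd.point_map \<in> coarse_homeomorphisms"
    unfolding coarse_homeomorphisms_def inv mem_Collect_eq homeomorphism_def
    using coarse fwd.continuous_point_map bwd.continuous_point_map
      surjI[of bwd.point_map fwd.point_map, OF bf.point_map_inverse] surjI[of fwd.point_map bwd.point_map, OF fb.point_map_inverse]
    by (simp add: fb.point_map_inverse bf.point_map_inverse)
  moreover have "fwd.weight \<in> multipliers B"
    unfolding multipliers_def mem_Collect_eq
  proof (intro conjI allI ballI fwd.weight_mem fwd.weight_pos)
    fix g assume g: "g \<in> B"
    have gA: "(\<lambda>x. g (bwd.point_map x)) \<in> A" by (intro pull_B[OF g] bwd.continuous_point_map coarse)
    have "T (\<lambda>x. g (bwd.point_map x)) = (\<lambda>y. fwd.weight y * g y)"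
      by (rule ext) (simp add: fwd.T_eq[OF gA] bf.point_map_inverse)
    with fwd.T_mem[OF gA] show "(\<lambda>y. fwd.weight y * g y) \<in> B" by simp
    have "bwd.weight (fwd.point_map y) = 1 / fwd.weight y" for y
      using bf.weight_product[of y] fwd.weight_pos[of y] by (simp add: field_simps)
    then have "(\<lambda>y. ?T' g (fwd.point_map y)) = (\<lambda>y. (1 / fwd.weight y) * g y)"
      by (intro ext) (simp only: bwd.T_eq[OF g] bf.point_map_inverse)
    moreover have "(\<lambda>y. ?T' g (fwd.point_map y)) \<in> B"
      by (intro pull_A[OF bwd.T_mem[OF g]] fwd.continuous_point_map coarse)
    ultimately show "(\<lambda>y. (1 / fwd.weight y) * g y) \<in> B" by simp
  qed
  moreover have "weighted_comp A (fwd.weight, bwd.point_map) = T"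
  proof (rule extensionalityI[of _ A])
    show "T \<in> extensional A" using assms(5) by (simp add: linear_lattice_isos_def)
  qed (auto simp: weighted_comp_def inv fwd.T_eq)
  ultimately show ?thesis by blast
qed

theorem weighted_comp_bij:
  assumes "chain_connected TYPE('a)" "\<not> bounded (UNIV :: 'a set)"
    and "chain_connected TYPE('b)" "\<not> bounded (UNIV :: 'b set)"
  shows "bij_betw (weighted_comp A)
    (multipliers B \<times> (coarse_homeomorphisms :: ('a \<Rightarrow> 'b) set)) (linear_lattice_isos A B)"
  unfolding bij_betw_def
proof (intro conjI weighted_comp_inj subset_antisym subsetI)
  fix T assume "T \<in> linear_lattice_isos A B"
  from weighted_comp_surj[OF assms this] obtain \<omega> \<tau> where "\<omega> \<in> multipliers B"
    "\<tau> \<in> coarse_homeomorphisms" "weighted_comp A (\<omega>, \<tau>) = T" by (elim bexE)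
  then show "T \<in> weighted_comp A ` (multipliers B \<times> coarse_homeomorphisms)"
    by (intro image_eqI[where x = "(\<omega>, \<tau>)"]) simp_all
next
  fix T assume "T \<in> weighted_comp A ` (multipliers B \<times> (coarse_homeomorphisms :: ('a \<Rightarrow> 'b) set))"
  then show "T \<in> linear_lattice_isos A B" by (elim imageE SigmaE) (simp add: weighted_comp_iso)
qed

end

theorem theorem4p11:
  assumes "proper_metric TYPE('a::metric_space)"
    and "proper_metric TYPE('b::metric_space)"
    and "chain_connected TYPE('a)"
    and "chain_connected TYPE('b)"
    and "\<not> bounded (UNIV :: 'a set)"
    and "\<not> bounded (UNIV :: 'b set)"
  shows "bij_betw (weighted_comp SO)
           ((SO_sharp :: ('b \<Rightarrow> real) set) \<times> (coarse_homeomorphisms :: ('a \<Rightarrow> 'b) set))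
           (linear_lattice_isos SO SO)
       \<and> bij_betw (weighted_comp SO_bdd)
           ((SO_sharp_bdd :: ('b \<Rightarrow> real) set) \<times> (coarse_homeomorphisms :: ('a \<Rightarrow> 'b) set))
           (linear_lattice_isos SO_bdd SO_bdd)"
proof
  note lattices = slow_lattice_SO[OF assms(1)] slow_lattice_SO[OF assms(2)]
    slow_lattice_SO_bdd[OF assms(1)] slow_lattice_SO_bdd[OF assms(2)]
  have sharp: "SO_sharp = multipliers SO" "SO_sharp_bdd = multipliers SO_bdd"
    by (simp_all only: SO_sharp_def SO_sharp_bdd_def multipliers_def)
  have "slow_lattice_pair (SO :: ('a \<Rightarrow> real) set) (SO :: ('b \<Rightarrow> real) set)"
    by (intro slow_lattice_pair.intro slow_lattice_pair_axioms.intro lattices)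
      (rule SO_comp_coarse; (rule assms | assumption))+
  from slow_lattice_pair.weighted_comp_bij[OF this assms(3,5,4,6)]
  show "bij_betw (weighted_comp SO)
      ((SO_sharp :: ('b \<Rightarrow> real) set) \<times> (coarse_homeomorphisms :: ('a \<Rightarrow> 'b) set))
      (linear_lattice_isos SO SO)" by (simp only: sharp)
  have "slow_lattice_pair (SO_bdd :: ('a \<Rightarrow> real) set) (SO_bdd :: ('b \<Rightarrow> real) set)"
  proof (intro slow_lattice_pair.intro slow_lattice_pair_axioms.intro lattices)
    show "(\<lambda>y. f (h y)) \<in> SO_bdd" if "f \<in> SO_bdd" "continuous_on UNIV h" "coarse_map h"
      for f :: "'a \<Rightarrow> real" and h :: "'b \<Rightarrow> 'a"
      using that SO_comp_coarse[OF assms(2,1) _ that(2,3), of f]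
      unfolding SO_bdd_def bounded_range_real_iff by blast
    show "(\<lambda>x. g (k x)) \<in> SO_bdd" if "g \<in> SO_bdd" "continuous_on UNIV k" "coarse_map k"
      for g :: "'b \<Rightarrow> real" and k :: "'a \<Rightarrow> 'b"
      using that SO_comp_coarse[OF assms(1,2) _ that(2,3), of g]
      unfolding SO_bdd_def bounded_range_real_iff by blast
  qed
  from slow_lattice_pair.weighted_comp_bij[OF this assms(3,5,4,6)]
  show "bij_betw (weighted_comp SO_bdd)
      ((SO_sharp_bdd :: ('b \<Rightarrow> real) set) \<times> (coarse_homeomorphisms :: ('a \<Rightarrow> 'b) set))
      (linear_lattice_isos SO_bdd SO_bdd)" by (simp only: sharp)
qed

end
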